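(* Let $\underline{s}\in S^{q-1}$. A function of the form $$F(\underline{x},\langle\underline{y},\underline{s}\rangle)=\sum_{j=0}^\infty \underline{x}^j \big(C_j(\langle\underline{y},\underline{s}\rangle)+\underline{s}\,D_j(\langle\underline{y},\underline{s}\rangle)\big),$$ where the functions $C_j$ and $D_j$ are complex-valued differentiable functions of one complex variable, is a hypermonogenic plane wave (i.e. satisfies $(\partial_{\underline{x}}+\partial_{\underline{y}})F=0$) if and only if for all $j\ge 0$ $$\beta_{j+1}C_{j+1}(t) -(-1)^j D'_j(t)=0,\qquad \beta_{j+1}D_{j+1}(t) +(-1)^j C'_j(t)=0,$$ where $t=\langle\underline{y},\underline{s}\rangle$, and it is determined by its initial functions $C_0(t)$ and $D_0(t)$.
   Context: $\mathbb{C}_{p+q}$ is the complex Clifford algebra with generators $e_1,\dots,e_{p+q}$ satisfying $e_ie_j+e_je_i=-2\delta_{ij}$. Vectors $\underline{x}\in\mathbb{R}^p$ and $\underline{y},\underline{s}\in\mathbb{R}^q$ are embedded as $\underline{x}=\sum_{j=1}^p x_je_j$, $\underline{y}=\sum_{j=1}^q y_je_{p+j}$, $\underline{s}=\sum_{j=1}^q s_je_{p+j}$; products and powers are Clifford products. $\langle\cdot,\cdot\rangle$ is the Euclidean inner product, $S^{q-1}$ the unit sphere of $\mathbb{R}^q$; $\partial_{\underline{x}}=\sum_{j=1}^p e_j\partial_{x_j}$, $\partial_{\underline{y}}=\sum_{j=1}^q e_{p+j}\partial_{y_j}$. The constants $\beta_j$ are given by $\partial_{\underline{x}}\underline{x}^j=\beta_j\underline{x}^{j-1}$,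 that is, $\beta_j=-j$ if $j$ is even and $\beta_j=-(j+p-1)$ if $j$ is odd. *)

theory Defs
  imports "HOL-Analysis.Analysis"
begin

section \<open>The complex Clifford algebra\<close>

text \<open>
  The generators are indexed by a finite linearly ordered type \<open>'n\<close>; an element is given by its
  complex coefficients with respect to the basis \<open>e\<^sub>A = e\<^sub>a\<^sub>1 \<cdots> e\<^sub>a\<^sub>k\<close>
  with \<open>A = {a\<^sub>1 < \<dots> < a\<^sub>k}\<close>.
\<close>

typedef 'n clifford = "UNIV :: ('n set \<Rightarrow> complex) set"
  morphisms coeff Clifford
  by simp

lemma coeff_Clifford [simp]: "coeff (Clifford f) = f"
  by (simp add: Clifford_inverse)

lemma clifford_eqI: "(\<And>A. coeff x A = coeff y A) \<Longrightarrow> x = y"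
  by (metis coeff_inject ext)

text \<open>
  \<open>e\<^sub>A e\<^sub>B = blade_sign A B e\<^sub>A\<^sub>\<triangle>\<^sub>B\<close>: each pair \<open>b < a\<close> costs one
  anticommutation, and each pair \<open>b = a\<close> one square \<open>e\<^sub>a\<^sup>2 = -1\<close>.
\<close>

definition blade_sign :: "'n::{finite,linorder} set \<Rightarrow> 'n set \<Rightarrow> complex" where
  "blade_sign A B = (\<Prod>a\<in>A. \<Prod>b\<in>B. if b \<le> a then -1 else 1)"

lemma prod_sym_diff:
  fixes f :: "'a::finite \<Rightarrow> complex"
  assumes "\<And>a. f a * f a = 1"
  shows "prod f (sym_diff A B) = prod f A * prod f B"
proof -
  have A: "prod f A = prod f (A - B) * prod f (A \<inter> B)"
    by (subst prod.union_disjoint [symmetric]) (auto intro: arg_cong [where f = "prod f"])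
  have B: "prod f B = prod f (B - A) * prod f (A \<inter> B)"
    by (subst prod.union_disjoint [symmetric]) (auto intro: arg_cong [where f = "prod f"])
  have C: "prod f (sym_diff A B) = prod f (A - B) * prod f (B - A)"
    by (rule prod.union_disjoint) auto
  have "prod f (A \<inter> B) * prod f (A \<inter> B) = 1"
    by (simp add: assms flip: prod.distrib)
  then show ?thesis
    unfolding A B C by (simp add: algebra_simps)
qed

lemma blade_sign_square: "blade_sign A B * blade_sign A B = 1"
  by (simp add: blade_sign_def if_distrib flip: prod.distrib cong: if_cong)

lemma blade_sign_left:
  "blade_sign (sym_diff A B) C = blade_sign A C * blade_sign B C"
  unfolding blade_sign_def
  by (rule prod_sym_diff) (simp add: if_distrib flip: prod.distrib cong: if_cong)

lemma blade_sign_right: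
  "blade_sign A (sym_diff B C) = blade_sign A B * blade_sign A C"
  unfolding blade_sign_def prod.distrib [symmetric]
  by (rule prod.cong [OF refl], rule prod_sym_diff) simp

lemma blade_sign_empty [simp]: "blade_sign {} A = 1" "blade_sign A {} = 1"
  by (simp_all add: blade_sign_def)

instantiation clifford :: ("{finite,linorder}") real_algebra_1
begin

definition "0 = Clifford (\<lambda>A. 0)"
definition "1 = Clifford (\<lambda>A. if A = {} then 1 else 0)"
definition "x + y = Clifford (\<lambda>A. coeff x A + coeff y A)"
definition "x - y = Clifford (\<lambda>A. coeff x A - coeff y A)"
definition "- x = Clifford (\<lambda>A. - coeff x A)"
definition "r *\<^sub>R x = Clifford (\<lambda>A. r *\<^sub>R coeff x A)"
definition "x * y = Clifford (\<lambda>S. \<Sum>A\<in>UNIV. \<Sum>B\<in>UNIV.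
  if sym_diff A B = S then blade_sign A B * coeff x A * coeff y B else 0)"

lemma coeff_simps [simp]:
  "coeff 0 A = 0"
  "coeff 1 A = (if A = {} then 1 else 0)"
  "coeff (x + y) A = coeff x A + coeff y A"
  "coeff (x - y) A = coeff x A - coeff y A"
  "coeff (- x) A = - coeff x A"
  "coeff (r *\<^sub>R x) A = r *\<^sub>R coeff x A"
  for x y :: "'a clifford"
  by (simp_all add: zero_clifford_def one_clifford_def plus_clifford_def minus_clifford_def
      uminus_clifford_def scaleR_clifford_def)

lemma coeff_mult:
  "coeff (x * y) S = (\<Sum>A\<in>UNIV. blade_sign A (sym_diff A S) * coeff x A * coeff y (sym_diff A S))"
  for x y :: "'a clifford"
proof -
  have "(sym_diff A B = S) = (sym_diff A S = B)" for A B :: "'a set" by blast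
  then show ?thesis
    by (simp add: times_clifford_def sum.delta')
qed

lemma clifford_mult_assoc: "(x * y) * z = x * (y * z)" for x y z :: "'a clifford"
proof (rule clifford_eqI)
  fix S
  have sgn: "blade_sign T (sym_diff T S) * blade_sign A (sym_diff A T) =
      blade_sign A (sym_diff A S) * blade_sign (sym_diff A T) (sym_diff T S)" for A T :: "'a set"
  proof -
    define B C where "B = sym_diff A T" and "C = sym_diff T S"
    have T: "T = sym_diff A B" and AS: "sym_diff A S = sym_diff B C"
      unfolding B_def C_def by blast+
    show ?thesis
      unfolding AS B_def [symmetric] C_def [symmetric] blade_sign_right
      by (subst T) (simp add: blade_sign_left)
  qed
  have bij: "bij_betw (sym_diff A) UNIV UNIV" for A :: "'a set"
    by (rule bij_betw_byWitness [where f' = "sym_diff A"]) auto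
  have "coeff ((x * y) * z) S = (\<Sum>A\<in>UNIV. \<Sum>T\<in>UNIV.
      blade_sign T (sym_diff T S) * blade_sign A (sym_diff A T) *
      (coeff x A * coeff y (sym_diff A T) * coeff z (sym_diff T S)))"
    unfolding coeff_mult
    by (subst sum.swap) (simp add: sum_distrib_left sum_distrib_right mult_ac)
  also have "\<dots> = (\<Sum>A\<in>UNIV. \<Sum>T\<in>UNIV.
      blade_sign A (sym_diff A S) * coeff x A *
      (blade_sign (sym_diff A T) (sym_diff (sym_diff A T) (sym_diff A S)) * coeff y (sym_diff A T) *
        coeff z (sym_diff (sym_diff A T) (sym_diff A S))))"
  proof (intro sum.cong refl)
    fix A T :: "'a set"
    have *: "sym_diff (sym_diff A T) (sym_diff A S) = sym_diff T S" by blast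
    show "blade_sign T (sym_diff T S) * blade_sign A (sym_diff A T) *
      (coeff x A * coeff y (sym_diff A T) * coeff z (sym_diff T S)) =
      blade_sign A (sym_diff A S) * coeff x A *
      (blade_sign (sym_diff A T) (sym_diff (sym_diff A T) (sym_diff A S)) * coeff y (sym_diff A T) *
        coeff z (sym_diff (sym_diff A T) (sym_diff A S)))"
      unfolding * sgn by (simp only: mult_ac)
  qed
  also have "\<dots> = (\<Sum>A\<in>UNIV. \<Sum>B\<in>UNIV.
      blade_sign A (sym_diff A S) * coeff x A *
      (blade_sign B (sym_diff B (sym_diff A S)) * coeff y B * coeff z (sym_diff B (sym_diff A S))))"
    by (rule sum.cong [OF refl], rule sum.reindex_bij_betw [OF bij])
  also have "\<dots> = coeff (x * (y * z)) S"
    unfolding coeff_mult by (simp add: sum_distrib_left)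
  finally show "coeff ((x * y) * z) S = coeff (x * (y * z)) S" .
qed

instance
proof
  fix x y z :: "'a clifford" and a b :: real
  show "x * y * z = x * (y * z)" by (rule clifford_mult_assoc)
  show "1 * x = x"
    by (rule clifford_eqI) (simp add: coeff_mult if_distrib if_distribR cong: if_cong)
  show "x * 1 = x"
  proof (rule clifford_eqI)
    fix S
    have "(sym_diff A S = {}) = (A = S)" for A :: "'a set" by blast
    then show "coeff (x * 1) S = coeff x S"
      by (simp add: coeff_mult if_distrib if_distribR cong: if_cong)
  qed
  show "(0::'a clifford) \<noteq> 1"
    by (metis coeff_simps(1,2) zero_neq_one)
qed (rule clifford_eqI, simp add: coeff_mult algebra_simps sum.distrib scaleR_sum_right)+

end

text \<open>
  All norms on this finite-dimensional space are equivalent; the sum norm makes the multiplication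
  submultiplicative and \<open>1\<close> a unit vector.
\<close>

instantiation clifford :: ("{finite,linorder}") real_normed_algebra_1
begin

definition "norm x = (\<Sum>A\<in>UNIV. norm (coeff x A))"
definition sgn_clifford_def: "sgn x = x /\<^sub>R norm (x :: 'a clifford)"
definition dist_clifford_def: "dist x y = norm (x - y :: 'a clifford)"
definition uniformity_clifford_def [code del]:
  "(uniformity :: ('a clifford \<times> 'a clifford) filter) =
    (INF e\<in>{0 <..}. principal {(x, y). dist x y < e})"
definition open_clifford_def [code del]:
  "open (U :: 'a clifford set) \<longleftrightarrow>
    (\<forall>x\<in>U. eventually (\<lambda>(x', y). x' = x \<longrightarrow> y \<in> U) uniformity)"

instance
proof
  fix x y :: "'a clifford" and r :: real
  show "(norm x = 0) = (x = 0)"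
  proof
    assume "norm x = 0"
    then have "\<forall>A\<in>UNIV. norm (coeff x A) = 0"
      unfolding norm_clifford_def by (subst (asm) sum_nonneg_eq_0_iff) auto
    then show "x = 0" by (intro clifford_eqI) simp
  qed (simp add: norm_clifford_def)
  show "norm (x + y) \<le> norm x + norm y"
    by (simp add: norm_clifford_def norm_triangle_ineq sum_mono flip: sum.distrib)
  show "norm (r *\<^sub>R x) = \<bar>r\<bar> * norm x"
    by (simp add: norm_clifford_def sum_distrib_left)
  show "norm (1 :: 'a clifford) = 1"
    by (simp add: norm_clifford_def if_distrib cong: if_cong)
  show "norm (x * y) \<le> norm x * norm y"
  proof -
    have sgn: "norm (blade_sign A B) = 1" for A B :: "'a set"
    proof -
      have "norm (blade_sign A B) * norm (blade_sign A B) = 1"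
        unfolding norm_mult [symmetric] blade_sign_square by (rule norm_one)
      then show ?thesis
        by (metis abs_norm_cancel abs_square_eq_1 power2_eq_square)
    qed
    have bij: "bij_betw (sym_diff A) UNIV UNIV" for A :: "'a set"
      by (rule bij_betw_byWitness [where f' = "sym_diff A"]) auto
    have "norm (x * y) \<le> (\<Sum>S\<in>UNIV. \<Sum>A\<in>UNIV. norm (coeff x A) * norm (coeff y (sym_diff A S)))"
      unfolding norm_clifford_def coeff_mult
      by (intro sum_mono order_trans [OF norm_sum]) (simp add: norm_mult sgn)
    also have "\<dots> = (\<Sum>A\<in>UNIV. \<Sum>S\<in>UNIV. norm (coeff x A) * norm (coeff y (sym_diff A S)))"
      by (rule sum.swap)
    also have "\<dots> = (\<Sum>A\<in>UNIV. \<Sum>B\<in>UNIV. norm (coeff x A) * norm (coeff y B))"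
      by (rule sum.cong [OF refl], rule sum.reindex_bij_betw [OF bij])
    also have "\<dots> = norm x * norm y"
      by (simp add: norm_clifford_def sum_product)
    finally show ?thesis .
  qed
qed (rule sgn_clifford_def dist_clifford_def open_clifford_def uniformity_clifford_def)+

end

definition clifford_of_complex :: "complex \<Rightarrow> 'n::{finite,linorder} clifford" where
  "clifford_of_complex c = Clifford (\<lambda>A. if A = {} then c else 0)"

definition gen :: "'n \<Rightarrow> 'n::{finite,linorder} clifford" where
  "gen i = Clifford (\<lambda>A. if A = {i} then 1 else 0)"

lemma coeff_gen_mult:
  "coeff (gen i * gen j) S =
    (if S = sym_diff {i} {j} then (if j \<le> i then -1 else 1) else 0)"
proof -
  define T where "T = sym_diff {i} S"
  have T: "T = {j} \<longleftrightarrow> S = sym_diff {i} {j}"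
    unfolding T_def by blast
  have "coeff (gen i * gen j) S =
      (\<Sum>A\<in>UNIV. if A = {i} then blade_sign {i} T * (if T = {j} then 1 else 0) else 0)"
    unfolding coeff_mult by (intro sum.cong refl) (simp only: gen_def coeff_Clifford T_def, simp)
  also have "\<dots> = blade_sign {i} T * (if T = {j} then 1 else 0)"
    by simp
  also have "\<dots> = (if T = {j} then (if j \<le> i then -1 else 1) else 0)"
    by (simp add: blade_sign_def)
  finally show ?thesis
    unfolding T .
qed

lemma gen_anticommute:
  "gen i * gen j + gen j * gen i = (if i = j then -2 else 0)"
proof (rule clifford_eqI)
  fix S
  have two: "coeff (2 :: 'a clifford) S = (if S = {} then 2 else 0)"
  proof -
    have "(2 :: 'a clifford) = 1 + 1" by simp
    then show ?thesis by (simp only: coeff_simps) simp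
  qed
  have comm: "sym_diff {j} {i} = sym_diff {i} {j}" by blast
  show "coeff (gen i * gen j + gen j * gen i) S =
      coeff (if i = j then - 2 else 0 :: 'a clifford) S"
  proof (cases "i = j")
    case True
    then show ?thesis
      by (simp only: coeff_simps coeff_gen_mult two if_True simp_thms) simp
  next
    case False
    then have "j \<le> i \<longleftrightarrow> \<not> i \<le> j" by auto
    then show ?thesis
      using False by (simp only: coeff_simps coeff_gen_mult comm if_False) simp
  qed
qed


section \<open>Vectors and Dirac operators in \<open>\<real>\<^sup>p \<times> \<real>\<^sup>q\<close>\<close>

text \<open>
  The \<open>p + q\<close> generators are indexed by \<open>'p + 'q\<close>: \<open>gen (Inl j)\<close> is \<open>e\<^sub>j\<close> and
  \<open>gen (Inr j)\<close> is \<open>e\<^sub>p\<^sub>+\<^sub>j\<close>, in this order.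
\<close>

instantiation sum :: (linorder, linorder) linorder
begin

fun less_eq_sum :: "'a + 'b \<Rightarrow> 'a + 'b \<Rightarrow> bool" where
  "Inl x \<le> Inl y \<longleftrightarrow> x \<le> y"
| "Inl x \<le> Inr y \<longleftrightarrow> True"
| "Inr x \<le> Inl y \<longleftrightarrow> False"
| "Inr x \<le> Inr y \<longleftrightarrow> x \<le> y"

definition less_sum :: "'a + 'b \<Rightarrow> 'a + 'b \<Rightarrow> bool" where
  "x < y \<longleftrightarrow> x \<le> y \<and> \<not> y \<le> (x :: 'a + 'b)"

instance
proof
  fix x y z :: "'a + 'b"
  show "(x < y) = (x \<le> y \<and> \<not> y \<le> x)" by (rule less_sum_def)
  show "x \<le> x" by (cases x) auto
  show "x \<le> y \<Longrightarrow> y \<le> z \<Longrightarrow> x \<le> z" by (cases x; cases y; cases z) auto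
  show "x \<le> y \<Longrightarrow> y \<le> x \<Longrightarrow> x = y" by (cases x; cases y) auto
  show "x \<le> y \<or> y \<le> x" by (cases x; cases y) auto
qed

end

definition vecx :: "real ^ 'p::_ \<Rightarrow> ('p::{finite,linorder} + 'q::{finite,linorder}) clifford" where
  "vecx x = (\<Sum>j\<in>UNIV. (x $ j) *\<^sub>R gen (Inl j))"

definition vecy :: "real ^ 'q::_ \<Rightarrow> ('p::{finite,linorder} + 'q::{finite,linorder}) clifford" where
  "vecy y = (\<Sum>j\<in>UNIV. (y $ j) *\<^sub>R gen (Inr j))"

text \<open>
  The two Dirac operators are built from the partial derivatives at a point. They are meaningful
  only where all partial derivatives exist, which \<open>hypermonogenic_on\<close> therefore requires.
\<close>

definition dirac_x ::
  "((real ^ 'p::_) \<times> (real ^ 'q::_) \<Rightarrow> ('p::{finite,linorder} + 'q::{finite,linorder}) clifford)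
    \<Rightarrow> real ^ 'p::_ \<Rightarrow> real ^ 'q::_ \<Rightarrow> ('p + 'q) clifford" where
  "dirac_x F x y =
    (\<Sum>j\<in>UNIV. gen (Inl j) * vector_derivative (\<lambda>h. F (x + h *\<^sub>R axis j 1, y)) (at 0))"

definition dirac_y ::
  "((real ^ 'p::_) \<times> (real ^ 'q::_) \<Rightarrow> ('p::{finite,linorder} + 'q::{finite,linorder}) clifford)
    \<Rightarrow> real ^ 'p::_ \<Rightarrow> real ^ 'q::_ \<Rightarrow> ('p + 'q) clifford" where
  "dirac_y F x y =
    (\<Sum>j\<in>UNIV. gen (Inr j) * vector_derivative (\<lambda>h. F (x, y + h *\<^sub>R axis j 1)) (at 0))"

definition hypermonogenic_on ::
  "((real ^ 'p::_) \<times> (real ^ 'q::_)) set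
    \<Rightarrow> ((real ^ 'p::_) \<times> (real ^ 'q::_) \<Rightarrow> ('p::{finite,linorder} + 'q::{finite,linorder}) clifford)
    \<Rightarrow> bool" where
  "hypermonogenic_on \<Omega> F \<longleftrightarrow> (\<forall>(x, y)\<in>\<Omega>.
    (\<forall>j. (\<lambda>h. F (x + h *\<^sub>R axis j 1, y)) differentiable (at (0::real))) \<and>
    (\<forall>j. (\<lambda>h. F (x, y + h *\<^sub>R axis j 1)) differentiable (at (0::real))) \<and>
    dirac_x F x y + dirac_y F x y = 0)"


section \<open>Plane waves\<close>

text \<open>
  \<open>beta p j\<close> is the constant \<open>\<beta>\<^sub>j\<close> with
  \<open>\<partial>\<^sub>x x\<^sup>j = \<beta>\<^sub>j x\<^sup>j\<^sup>-\<^sup>1\<close> for the vector variable \<open>x \<in> \<real>\<^sup>p\<close>.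
\<close>

definition beta :: "nat \<Rightarrow> nat \<Rightarrow> complex" where
  "beta p j = (if even j then - of_nat j else - (of_nat j + of_nat p - 1))"

text \<open>
  \<open>F\<close> is on \<open>\<Omega>\<close> the pointwise sum of the series with coefficients
  \<open>C\<^sub>j(\<langle>y, s\<rangle>) + s D\<^sub>j(\<langle>y, s\<rangle>)\<close>; the \<open>C\<^sub>j\<close>, \<open>D\<^sub>j\<close> are functions of a complex variable
  evaluated at the real number \<open>\<langle>y, s\<rangle>\<close>.
\<close>

definition plane_wave_on ::
  "((real ^ 'p::_) \<times> (real ^ 'q::_)) set \<Rightarrow> real ^ 'q::_
    \<Rightarrow> (nat \<Rightarrow> complex \<Rightarrow> complex) \<Rightarrow> (nat \<Rightarrow> complex \<Rightarrow> complex)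
    \<Rightarrow> ((real ^ 'p::_) \<times> (real ^ 'q::_) \<Rightarrow> ('p::{finite,linorder} + 'q::{finite,linorder}) clifford)
    \<Rightarrow> bool" where
  "plane_wave_on \<Omega> s C D F \<longleftrightarrow> (\<forall>(x, y)\<in>\<Omega>.
    (\<lambda>j. vecx x ^ j * (clifford_of_complex (C j (of_real (y \<bullet> s)))
           + vecy s * clifford_of_complex (D j (of_real (y \<bullet> s))))) sums F (x, y))"

end

theory Submission
  imports Defs "HOL-Complex_Analysis.Conformal_Mappings"
begin

text \<open>
  Collect the coefficients into Clifford-valued amplitudes \<open>w\<^sub>j(t) = C\<^sub>j(t) + s D\<^sub>j(t)\<close>, so that
  \<open>F = \<Sum> x\<^sup>j w\<^sub>j(\<langle>y, s\<rangle>)\<close>. On a function of \<open>\<langle>y, s\<rangle>\<close> the operator \<open>\<partial>\<^sub>y\<close> is left multiplication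
  of the derivative by \<open>s\<close>, on \<open>x\<^sup>j\<close> the operator \<open>\<partial>\<^sub>x\<close> gives \<open>\<beta>\<^sub>j x\<^sup>j\<^sup>-\<^sup>1\<close>, and \<open>s\<close> anticommutes with \<open>x\<close>
  and squares to \<open>-1\<close>. Hence \<open>(\<partial>\<^sub>x + \<partial>\<^sub>y) F = 0\<close> says, at every point, that
  \<open>d/dt \<Sum> x\<^sup>j w\<^sub>j(t) = \<Sum> x\<^sup>j z\<^sub>j(t)\<close> with \<open>z\<^sub>j = (-1)\<^sup>j \<beta>\<^sub>j\<^sub>+\<^sub>1 s w\<^sub>j\<^sub>+\<^sub>1\<close>
  (\<open>hypermonogenic_iff_profile_derivative\<close>), while the asserted recurrence is \<open>w\<^sub>j' = z\<^sub>j\<close>, because \<open>1\<close>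
  and \<open>s\<close> are linearly independent over the complex numbers (\<open>recurrence_iff\<close>).
  
  The substance is the passage between these two, since the series is only assumed to converge
  pointwise. In the variable \<open>x\<close> there is no difficulty: as \<open>x\<^sup>2 = - |x|\<^sup>2\<close>, for fixed \<open>t\<close> the series behaves
  like a power series in \<open>|x|\<close>, and openness of \<open>\<Omega>\<close> provides convergence at a larger radius. In the
  variable \<open>t\<close> the two directions need different arguments.
  
  If the recurrence holds, then \<open>C\<^sub>0, D\<^sub>1, C\<^sub>2, D\<^sub>3, \<dots>\<close> are, up to explicit constants, the successive
  derivatives of \<open>C\<^sub>0\<close>, and likewise for \<open>D\<^sub>0, C\<^sub>1, D\<^sub>2, \<dots>\<close>. As \<open>|\<beta>\<^sub>j|\<close> lies between \<open>j\<close> and \<open>j + p\<close>, bounds on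
  the terms at a single \<open>t\<close> bound the Taylor coefficients there, and Cauchy's inequality turns this into
  bounds that are uniform near \<open>t\<close> (\<open>derivative_chain_locally_bounded\<close>). Termwise differentiation is
  then legitimate.
  
  If \<open>F\<close> is hypermonogenic, no uniform bounds are available a priori. By Baire's theorem they do exist
  on a subinterval of every interval of values \<open>t\<close>. There the series of the \<open>z\<^sub>j\<close> can be integrated term
  by term, and comparing coefficients of powers of the radius gives \<open>w\<^sub>j' = z\<^sub>j\<close>. This holds on a dense
  set, hence everywhere by continuity (\<open>power_series_coeff_derivative\<close>).
  
  Finally \<open>\<beta>\<^sub>j\<^sub>+\<^sub>1 \<noteq> 0\<close>, so the recurrence computes \<open>C\<^sub>j\<^sub>+\<^sub>1\<close> and \<open>D\<^sub>j\<^sub>+\<^sub>1\<close> from the derivatives of \<open>D\<^sub>j\<close> and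
  \<open>C\<^sub>j\<close>. The values \<open>\<langle>y, s\<rangle>\<close> fill an open set of reals, so these derivatives depend only on values there,
  and the initial functions determine everything.
\<close>

section \<open>Series differentiated term by term\<close>
lemma summable_linear_times_geometric:
  fixes q :: real
  assumes "0 \<le> q" "q < 1"
  shows "summable (\<lambda>j. real (j + m) * q ^ j)"
proof (rule summable_comparison_test' [of _ 0])
  show "summable (\<lambda>j. real (m + 1) * (real (Suc j) * q ^ j))"
    using geometric_deriv_sums [of q] assms by (intro summable_mult) (auto simp: sums_iff)
  fix j :: nat
  have "real (j + m) \<le> real ((m + 1) * Suc j)"
    by (simp only: of_nat_le_iff) simp
  then have "real (j + m) * q ^ j \<le> real ((m + 1) * Suc j) * q ^ j"
    using assms by (intro mult_right_mono) auto
  then show "norm (real (j + m) * q ^ j) \<le> real (m + 1) * (real (Suc j) * q ^ j)"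
    using assms by (simp only: of_nat_mult mult.assoc) simp
qed

lemma termwise_vector_derivative:
  fixes f :: "nat \<Rightarrow> real \<Rightarrow> 'b::banach"
  assumes "0 < \<delta>"
    and deriv: "\<And>n t. \<bar>t - t0\<bar> < \<delta> \<Longrightarrow> (f n has_vector_derivative f' n t) (at t)"
    and bound: "\<And>n t. \<bar>t - t0\<bar> < \<delta> \<Longrightarrow> norm (f' n t) \<le> M n"
    and "summable M" and "summable (\<lambda>n. f n t0)"
  shows "((\<lambda>t. \<Sum>n. f n t) has_vector_derivative (\<Sum>n. f' n t0)) (at t0)"
proof -
  let ?S = "ball t0 \<delta>"
  have S: "t \<in> ?S \<longleftrightarrow> \<bar>t - t0\<bar> < \<delta>" for t
    by (auto simp: dist_real_def)
  have unif: "uniform_limit ?S (\<lambda>n t. \<Sum>i<n. f' i t) (\<lambda>t. \<Sum>i. f' i t) sequentially"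
    by (rule Weierstrass_m_test [OF _ \<open>summable M\<close>]) (use bound S in blast)
  have "\<exists>g. \<forall>t\<in>?S. (\<lambda>n. f n t) sums g t \<and>
      (g has_derivative (\<lambda>h. h *\<^sub>R (\<Sum>i. f' i t))) (at t within ?S)"
  proof (rule has_derivative_series)
    show "(f n has_derivative (\<lambda>h. h *\<^sub>R f' n t)) (at t within ?S)" if "t \<in> ?S" for n t
      using deriv that S has_vector_derivative_def has_derivative_at_withinI by blast
    show "\<forall>\<^sub>F n in sequentially. \<forall>t\<in>?S. \<forall>h.
        norm ((\<Sum>i<n. h *\<^sub>R f' i t) - h *\<^sub>R (\<Sum>i. f' i t)) \<le> e * norm h" if "e > 0" for e
      using uniform_limitD [OF unif that]
    proof eventually_elim
      case (elim n)
      have "norm ((\<Sum>i<n. h *\<^sub>R f' i t) - h *\<^sub>R (\<Sum>i. f' i t)) \<le> e * norm h"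
        if "t \<in> ?S" for t h
      proof -
        have "norm ((\<Sum>i<n. h *\<^sub>R f' i t) - h *\<^sub>R (\<Sum>i. f' i t))
            = \<bar>h\<bar> * norm ((\<Sum>i<n. f' i t) - (\<Sum>i. f' i t))"
          by (simp flip: scaleR_sum_right scaleR_diff_right)
        also have "\<dots> \<le> \<bar>h\<bar> * e"
          using elim that by (intro mult_left_mono) (auto simp: dist_norm less_imp_le)
        finally show ?thesis by (simp add: mult.commute)
      qed
      then show ?case by blast
    qed
    show "t0 \<in> ?S" "(\<lambda>n. f n t0) sums (\<Sum>n. f n t0)"
      using assms by (auto intro: summable_sums)
  qed simp
  then obtain g where g: "\<And>t. t \<in> ?S \<Longrightarrow> (\<lambda>n. f n t) sums g t"
    "\<And>t. t \<in> ?S \<Longrightarrow> (g has_derivative (\<lambda>h. h *\<^sub>R (\<Sum>i. f' i t))) (at t within ?S)"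
    by blast
  have "(g has_vector_derivative (\<Sum>i. f' i t0)) (at t0)"
    using g(2) [of t0] \<open>0 < \<delta>\<close> by (simp add: has_vector_derivative_def at_within_open [of _ ?S])
  then show ?thesis
    by (rule has_vector_derivative_transform_within_open [of _ _ _ ?S])
      (use \<open>0 < \<delta>\<close> g(1) in \<open>auto simp: sums_iff\<close>)
qed

section \<open>Power series whose coefficients depend on a real parameter\<close>

text \<open>
  The interval may stay away from the centre \<open>0\<close>, so the coefficients are reached by analytic
  continuation along the disc.
\<close>
lemma power_series_zero_on_interval:
  fixes c :: "nat \<Rightarrow> complex"
  assumes ab: "0 \<le> a" "a < b"
    and zero: "\<And>r. a < r \<Longrightarrow> r < b \<Longrightarrow> (\<lambda>j. c j * of_real r ^ j) sums 0"
  shows "c j = 0"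
proof -
  define g where "g z = (\<Sum>j. c j * z ^ j)" for z
  have sm: "(\<lambda>j. c j * z ^ j) sums g z" if z: "norm z < b" for z
  proof -
    obtain r where r: "max (norm z) a < r" "r < b"
      using dense [of "max (norm z) a" b] z ab by auto
    have "summable (\<lambda>j. c j * of_real r ^ j)"
      using zero [of r] r by (auto simp: sums_iff)
    then have "summable (\<lambda>j. c j * z ^ j)"
      by (rule powser_inside) (use r ab in auto)
    then show ?thesis by (simp add: g_def summable_sums)
  qed
  have hol: "g holomorphic_on ball 0 b"
    by (rule power_series_holomorphic [where a = c]) (use sm in simp)
  let ?U = "of_real ` {a<..<b} :: complex set" and ?m = "of_real ((a + b) / 2) :: complex"
  have "(a + b) / 2 islimpt {a<..<b}"
    using ab by (intro interior_limit_point) auto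
  have lim: "?m islimpt ?U"
    unfolding islimpt_approachable
  proof (intro allI impI)
    fix e :: real assume "e > 0"
    then obtain r where "r \<in> {a<..<b}" "r \<noteq> (a + b) / 2" "dist r ((a + b) / 2) < e"
      using \<open>(a + b) / 2 islimpt {a<..<b}\<close> unfolding islimpt_approachable by blast
    then show "\<exists>z\<in>?U. z \<noteq> ?m \<and> dist z ?m < e"
      by (intro bexI [of _ "of_real r"]) (auto simp: dist_of_real simp del: of_real_divide of_real_add)
  qed
  have g0: "g w = 0" if "norm w < b" for w
  proof (rule analytic_continuation [OF hol, of ?U ?m])
    show "?U \<subseteq> ball 0 b" using ab by auto
    show "?m \<in> ball 0 b" using ab by (simp add: dist_norm norm_divide del: of_real_add flip: of_real_add)
    show "g z = 0" if "z \<in> ?U" for z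
      using that zero by (auto simp: g_def sums_iff)
  qed (use that lim in auto)
  have "0 < b" using ab by simp
  have c0: "c 0 = 0"
    using sm [of 0] g0 [of 0] \<open>0 < b\<close> by simp
  show ?thesis
  proof (rule ccontr)
    assume ne: "c j \<noteq> 0"
    then have "j > 0" using c0 by (cases j) auto
    obtain s where s: "0 < s" "\<And>z. z \<in> cball 0 s - {0} \<Longrightarrow> g z \<noteq> 0"
      using powser_0_nonzero [of b 0 c g j] sm g0 [of 0] \<open>0 < b\<close> ne \<open>j > 0\<close> by auto
    define z where "z = complex_of_real (min s (b / 2))"
    have "norm z = min s (b / 2)"
      unfolding z_def norm_of_real using s(1) \<open>0 < b\<close> by simp
    then have "norm z < b" "z \<in> cball 0 s - {0}"
      using s(1) \<open>0 < b\<close> by auto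
    then show False
      using s(2) g0 by blast
  qed
qed

text \<open>
  The closed sets on which all \<open>f n\<close> are bounded by \<open>k\<close> exhaust the interval as \<open>k\<close> grows, so by
  Baire's theorem one of them has an interior point.
\<close>
lemma pointwise_bounded_imp_uniformly_bounded_subinterval:
  fixes f :: "nat \<Rightarrow> real \<Rightarrow> 'b::real_normed_vector"
  assumes "a < b" and cont: "\<And>n. continuous_on {a..b} (f n)"
    and bound: "\<And>t. t \<in> {a..b} \<Longrightarrow> \<exists>K. \<forall>n. norm (f n t) \<le> K"
  obtains c d K where "a \<le> c" "c < d" "d \<le> b" "\<And>n t. t \<in> {c..d} \<Longrightarrow> norm (f n t) \<le> K"
proof -
  let ?S = "{a..b}"
  define E where "E k = {t\<in>?S. \<forall>n. norm (f n t) \<le> real k}" for k :: nat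
  have closed: "closed (E k)" for k
  proof -
    have "E k = (\<Inter>n. {t\<in>?S. norm (f n t) \<le> real k})"
      by (auto simp: E_def)
    moreover have "closed {t\<in>?S. norm (f n t) \<le> real k}" for n
      by (intro continuous_on_closed_Collect_le continuous_intros cont)
    ultimately show ?thesis by auto
  qed
  have empty: "(\<Inter>k. ?S - E k) = {}"
  proof -
    have "\<exists>k. t \<in> E k" if "t \<in> ?S" for t
    proof -
      obtain K where K: "\<And>n. norm (f n t) \<le> K" using bound \<open>t \<in> ?S\<close> by blast
      obtain k :: nat where "K \<le> real k" using real_arch_simple by blast
      with K that show ?thesis by (auto simp: E_def intro: order_trans)
    qed
    then show ?thesis by auto
  qed
  have "\<exists>k. \<not> ?S \<subseteq> closure (?S - E k)"
  proof (rule ccontr)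
    assume dense: "\<not> ?thesis"
    have "?S \<subseteq> closure (\<Inter> (range (\<lambda>k. ?S - E k)))"
    proof (rule Baire)
      fix T assume "T \<in> range (\<lambda>k. ?S - E k)"
      then obtain k where T: "T = ?S - E k" by blast
      have "openin (top_of_set ?S) (?S \<inter> - E k)"
        using closed by (intro openin_open_Int) (simp add: open_Compl)
      then show "openin (top_of_set ?S) T \<and> ?S \<subseteq> closure T"
        using dense by (auto simp: T Diff_eq)
    qed auto
    then show False unfolding empty using \<open>a < b\<close> by simp
  qed
  then obtain k t where t: "t \<in> ?S" "t \<notin> closure (?S - E k)" by blast
  from t(2) obtain e where e: "e > 0" "\<forall>u\<in>?S - E k. \<not> dist u t < e"
    unfolding closure_approachable by blast
  define c d where "c = max a (t - e / 2)" and "d = min b (t + e / 2)"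
  show ?thesis
  proof (rule that)
    show "a \<le> c" "c < d" "d \<le> b"
      using \<open>a < b\<close> t(1) e(1) by (auto simp: c_def d_def)
    show "norm (f n u) \<le> real k" if "u \<in> {c..d}" for n u
    proof -
      have "u \<in> ?S" "\<bar>u - t\<bar> < e"
        using that e(1) by (auto simp: c_def d_def)
      then show ?thesis using e(2) by (auto simp: E_def dist_real_def)
    qed
  qed
qed

text \<open>
  A sum \<open>\<Sum> V\<^sub>j(t) r\<^sup>j\<close> that converges only pointwise may have a derivative in \<open>t\<close> that is again a power
  series in \<open>r\<close>. On a subinterval where the new coefficients are uniformly bounded this derivative can
  be integrated term by term, and equality of power series in \<open>r\<close> gives \<open>V\<^sub>j(u) - V\<^sub>j(c) = \<integral> Z\<^sub>j\<close>.
\<close>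
lemma power_series_coeff_derivative_somewhere:
  fixes V V' Z :: "nat \<Rightarrow> real \<Rightarrow> complex"
  assumes "a < b" and r01: "0 \<le> r0" "r0 < r1"
    and V': "\<And>j t. t \<in> {a..b} \<Longrightarrow> (V j has_vector_derivative V' j t) (at t within {a..b})"
    and contZ: "\<And>j. continuous_on {a..b} (Z j)"
    and V_sums: "\<And>r t. r0 < r \<Longrightarrow> r < r1 \<Longrightarrow> t \<in> {a..b} \<Longrightarrow>
      (\<lambda>j. V j t * of_real r ^ j) sums f r t"
    and f': "\<And>r t. r0 < r \<Longrightarrow> r < r1 \<Longrightarrow> t \<in> {a..b} \<Longrightarrow>
      (f r has_vector_derivative (\<Sum>j. Z j t * of_real r ^ j)) (at t within {a..b})"
    and Z_bound: "\<And>t. t \<in> {a..b} \<Longrightarrow> \<exists>K. \<forall>j. norm (Z j t) * r1 ^ j \<le> K"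
  shows "\<exists>t\<in>{a<..<b}. \<forall>j. V' j t = Z j t"
proof -
  have "\<exists>K. \<forall>j. norm (Z j t * of_real r1 ^ j) \<le> K" if "t \<in> {a..b}" for t
    using Z_bound [OF that] r01 by (simp add: norm_mult norm_power)
  moreover have "continuous_on {a..b} (\<lambda>t. Z j t * of_real r1 ^ j)" for j
    by (intro continuous_intros contZ)
  ultimately obtain c d K where cd: "a \<le> c" "c < d" "d \<le> b"
    and "\<And>j t. t \<in> {c..d} \<Longrightarrow> norm (Z j t * of_real r1 ^ j) \<le> K"
    using pointwise_bounded_imp_uniformly_bounded_subinterval
      [of a b "\<lambda>j t. Z j t * of_real r1 ^ j"] \<open>a < b\<close> by blast
  then have K: "norm (Z j t) \<le> K / r1 ^ j" if "t \<in> {c..d}" for j t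
    using that r01 by (fastforce simp: norm_mult norm_power field_simps)
  have sub: "{c..u} \<subseteq> {a..b}" if "u \<le> d" for u using cd that by auto
  have eq: "V j u - V j c = integral {c..u} (Z j)" if u: "u \<in> {c..d}" for u j
  proof -
    have "V j u - V j c - integral {c..u} (Z j) = 0"
    proof (rule power_series_zero_on_interval [OF r01, where c = "\<lambda>j. V j u - V j c - integral {c..u} (Z j)"])
      fix r assume r: "r0 < r" "r < r1"
      have contZu: "continuous_on {c..u} (Z j)" for j
        using contZ sub u by (meson atLeastAtMost_iff continuous_on_subset)
      have unif: "uniform_limit {c..u} (\<lambda>n t. \<Sum>j<n. Z j t * of_real r ^ j)
          (\<lambda>t. \<Sum>j. Z j t * of_real r ^ j) sequentially"
      proof (rule Weierstrass_m_test)
        show "norm (Z j t * of_real r ^ j) \<le> K * (r / r1) ^ j" if "t \<in> {c..u}" for j t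
        proof -
          have "norm (Z j t) * r ^ j \<le> K / r1 ^ j * r ^ j"
            using K [of t j] that u r r01 by (intro mult_right_mono) auto
          then show ?thesis
            using r r01 by (simp add: norm_mult norm_power power_divide)
        qed
        show "summable (\<lambda>j. K * (r / r1) ^ j)"
          using r r01 by (intro summable_mult summable_geometric) auto
      qed
      obtain I J where I: "\<And>n. ((\<lambda>t. \<Sum>j<n. Z j t * of_real r ^ j) has_integral I n) {c..u}"
        and J: "((\<lambda>t. \<Sum>j. Z j t * of_real r ^ j) has_integral J) {c..u}" and lim: "I \<longlonglongrightarrow> J"
        by (rule uniform_limit_integral [OF unif]) (auto intro!: continuous_intros contZu)
      have "((\<lambda>t. \<Sum>j. Z j t * of_real r ^ j) has_integral f r u - f r c) {c..u}"
        by (rule fundamental_theorem_of_calculus)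
          (use u in simp, rule has_vector_derivative_within_subset [OF f' [OF r] sub], use u cd in auto)
      then have "J = f r u - f r c" using J has_integral_unique by blast
      moreover have "I = (\<lambda>n. \<Sum>j<n. integral {c..u} (Z j) * of_real r ^ j)"
      proof
        fix n
        have "((\<lambda>t. \<Sum>j<n. Z j t * of_real r ^ j) has_integral
            (\<Sum>j<n. integral {c..u} (Z j) * of_real r ^ j)) {c..u}"
          by (intro has_integral_sum has_integral_mult_left integrable_integral
              integrable_continuous_real contZu) auto
        then show "I n = (\<Sum>j<n. integral {c..u} (Z j) * of_real r ^ j)"
          using I has_integral_unique by blast
      qed
      ultimately have int: "(\<lambda>j. integral {c..u} (Z j) * of_real r ^ j) sums (f r u - f r c)"
        using lim by (simp add: sums_def)
      have "(\<lambda>j. V j u * of_real r ^ j - V j c * of_real r ^ j) sums (f r u - f r c)"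
        using V_sums r u cd by (intro sums_diff) auto
      from sums_diff [OF this int]
      show "(\<lambda>j. (V j u - V j c - integral {c..u} (Z j)) * of_real r ^ j) sums 0"
        by (simp add: algebra_simps)
    qed
    then show ?thesis by simp
  qed
  \<comment> \<open>Differentiating the integral identity at an interior point gives the claim there.\<close>
  define m where "m = (c + d) / 2"
  have m: "m \<in> {c..d}" "m \<in> {a<..<b}" using cd by (auto simp: m_def)
  have "V' j m = Z j m" for j
  proof -
    have "((\<lambda>u. integral {c..u} (Z j)) has_vector_derivative Z j m) (at m within {c..d})"
      by (intro integral_has_vector_derivative continuous_on_subset [OF contZ sub] m) auto
    then have "((\<lambda>u. V j u - V j c) has_vector_derivative Z j m) (at m within {c..d})"
      by (rule has_vector_derivative_transform [rotated -1]) (use m eq in auto)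
    moreover have "((\<lambda>u. V j u - V j c) has_vector_derivative V' j m) (at m within {c..d})"
      using V' [of m j] m sub [of d]
      by (auto intro!: derivative_eq_intros intro: has_vector_derivative_within_subset)
    ultimately show ?thesis
      using vector_derivative_unique_within_closed_interval [of c d m] m cd by auto
  qed
  then show ?thesis using m by blast
qed

text \<open>
  The previous lemma applies to every subinterval, so equality holds on a dense set; continuity of
  \<open>V' j\<close> and \<open>Z j\<close> extends it.
\<close>
lemma power_series_coeff_derivative:
  fixes V V' Z :: "nat \<Rightarrow> real \<Rightarrow> complex"
  assumes r01: "0 \<le> r0" "r0 < r1"
    and V': "\<And>j t. t \<in> {a..b} \<Longrightarrow> (V j has_vector_derivative V' j t) (at t)"
    and cont: "\<And>j. continuous_on {a..b} (V' j)" "\<And>j. continuous_on {a..b} (Z j)"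
    and V_sums: "\<And>r t. r0 < r \<Longrightarrow> r < r1 \<Longrightarrow> t \<in> {a..b} \<Longrightarrow>
      (\<lambda>j. V j t * of_real r ^ j) sums f r t"
    and f': "\<And>r t. r0 < r \<Longrightarrow> r < r1 \<Longrightarrow> t \<in> {a..b} \<Longrightarrow>
      (f r has_vector_derivative (\<Sum>j. Z j t * of_real r ^ j)) (at t)"
    and Z_bound: "\<And>t. t \<in> {a..b} \<Longrightarrow> \<exists>K. \<forall>j. norm (Z j t) * r1 ^ j \<le> K"
    and t: "a < t" "t < b"
  shows "V' j t = Z j t"
proof (rule ccontr)
  assume ne: "V' j t \<noteq> Z j t"
  have "continuous_on {a<..<b} (\<lambda>u. V' j u - Z j u)"
    by (intro continuous_on_diff continuous_on_subset [OF cont(1)]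
        continuous_on_subset [OF cont(2)]) auto
  then have "open ({a<..<b} \<inter> (\<lambda>u. V' j u - Z j u) -` (- {0}))"
    by (rule continuous_open_preimage) (auto simp: open_Compl)
  moreover have "t \<in> {a<..<b} \<inter> (\<lambda>u. V' j u - Z j u) -` (- {0})"
    using ne t by simp
  ultimately obtain e where e: "e > 0"
    "cball t e \<subseteq> {a<..<b} \<inter> (\<lambda>u. V' j u - Z j u) -` (- {0})"
    using open_contains_cball by blast
  have "u \<in> {a..b} \<and> V' j u \<noteq> Z j u" if "u \<in> {t - e..t + e}" for u
    using subsetD [OF e(2), of u] that by (simp add: cball_eq_atLeastAtMost)
  then have sub: "{t - e..t + e} \<subseteq> {a..b}"
    and neq: "\<And>u. u \<in> {t - e..t + e} \<Longrightarrow> V' j u \<noteq> Z j u"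
    by blast+
  have "\<exists>u\<in>{t - e<..<t + e}. \<forall>j. V' j u = Z j u"
  proof (rule power_series_coeff_derivative_somewhere [OF _ r01])
    show "(V j has_vector_derivative V' j u) (at u within {t - e..t + e})"
      if "u \<in> {t - e..t + e}" for j u
      by (rule has_vector_derivative_at_within, rule V') (use that sub in auto)
    show "(f r has_vector_derivative (\<Sum>j. Z j u * of_real r ^ j)) (at u within {t - e..t + e})"
      if "r0 < r" "r < r1" "u \<in> {t - e..t + e}" for r u
      by (rule has_vector_derivative_at_within, rule f') (use that sub in auto)
    show "continuous_on {t - e..t + e} (Z j)" for j
      using cont(2) sub continuous_on_subset by blast
  qed (use e(1) sub V_sums Z_bound in auto)
  then show False using neq by (metis atLeastAtMost_iff greaterThanLessThan_iff less_imp_le)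
qed

section \<open>Holomorphic functions along the real line\<close>
lemma deriv_eq_of_eq_on_reals:
  assumes "f holomorphic_on U" "g holomorphic_on U" "open U" "open T"
    and TU: "\<And>t. t \<in> T \<Longrightarrow> complex_of_real t \<in> U"
    and eq: "\<And>t. t \<in> T \<Longrightarrow> f (of_real t) = g (of_real t)"
    and "t \<in> T"
  shows "deriv f (of_real t) = deriv g (of_real t)"
proof -
  have f: "((\<lambda>t. f (of_real t)) has_vector_derivative deriv f (of_real t)) (at t)"
    and g: "((\<lambda>t. g (of_real t)) has_vector_derivative deriv g (of_real t)) (at t)"
    using assms by (auto intro!: has_vector_derivative_real_field holomorphic_derivI)
  have "((\<lambda>t. g (of_real t)) has_vector_derivative deriv f (of_real t)) (at t)"
    using f by (rule has_vector_derivative_transform_within_open) (use assms in auto)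
  then show ?thesis using g vector_derivative_unique_at by blast
qed

text \<open>
  On \<open>T\<close> each \<open>P j\<close> is \<open>(deriv ^^ j) (P 0)\<close> divided by \<open>b 1 \<cdots> b j\<close>, a product between \<open>j!\<close> and \<open>j!\<close> times a
  polynomial in \<open>j\<close>. The bound at \<open>t0\<close> therefore forces the Taylor series of \<open>P 0\<close> at \<open>t0\<close> to converge in
  the disc of radius \<open>R\<close>, even where that disc leaves \<open>U\<close>, and Cauchy's inequality for this Taylor
  series bounds all its derivatives near \<open>t0\<close>.
\<close>
lemma derivative_chain_locally_bounded:
  fixes P :: "nat \<Rightarrow> complex \<Rightarrow> complex" and b :: "nat \<Rightarrow> complex" and m :: nat
  assumes U: "open U" "\<And>j. P j holomorphic_on U"
    and T: "open T" "\<And>t. t \<in> T \<Longrightarrow> of_real t \<in> U" "t0 \<in> T"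
    and rec: "\<And>j t. t \<in> T \<Longrightarrow> deriv (P j) (of_real t) = b (Suc j) * P (Suc j) (of_real t)"
    and b: "\<And>j. 0 < j \<Longrightarrow> real j \<le> norm (b j)" "\<And>j. norm (b j) \<le> real (j + m)"
    and K: "\<And>j. norm (P j (of_real t0)) * R ^ j \<le> K"
    and \<rho>: "0 < \<rho>" "\<rho> < R"
  obtains \<eta> B where "0 < \<eta>"
    "\<And>t. \<bar>t - t0\<bar> < \<eta> \<Longrightarrow> t \<in> T" "\<And>t j. \<bar>t - t0\<bar> < \<eta> \<Longrightarrow> norm (P j (of_real t)) * \<rho> ^ j \<le> B"
proof -
  let ?z0 = "complex_of_real t0" and ?b = "\<lambda>j. \<Prod>i=1..j. b i"
  have chain: "(deriv ^^ j) (P 0) (of_real t) = ?b j * P j (of_real t)" if "t \<in> T" for j t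
    using that
  proof (induction j arbitrary: t)
    case (Suc j)
    have "(deriv ^^ Suc j) (P 0) (of_real t) = deriv (\<lambda>z. ?b j * P j z) (of_real t)"
      unfolding funpow.simps o_def
      by (rule deriv_eq_of_eq_on_reals [OF _ _ U(1) T(1)])
        (use U T Suc in \<open>auto intro!: holomorphic_intros\<close>)
    also have "\<dots> = ?b j * deriv (P j) (of_real t)"
      using U T Suc.prems by (intro deriv_cmult) (auto simp: holomorphic_on_open field_differentiable_def)
    also have "\<dots> = ?b (Suc j) * P (Suc j) (of_real t)"
      using rec Suc.prems by simp
    finally show ?case .
  qed simp
  define a where "a j = (deriv ^^ j) (P 0) ?z0 / fact j" for j
  have "0 \<le> K" using order_trans [OF norm_ge_zero, of "P 0 ?z0" K] K [of 0] by simp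
  have a_summable: "summable (\<lambda>j. a j * w ^ j)" if w: "norm w < R" for w
  proof -
    define h where "h j = (\<Prod>i=1..j. real (i + m) / real i) * (norm w / R) ^ j * K" for j
    have h_nonneg: "0 \<le> h j" for j
      using \<rho> \<open>0 \<le> K\<close> by (auto simp: h_def intro!: mult_nonneg_nonneg prod_nonneg)
    have le: "norm (a j * w ^ j) \<le> h j" for j
    proof -
      have "norm (?b j) \<le> (\<Prod>i=1..j. real (i + m))"
        unfolding prod_norm [symmetric] by (intro prod_mono) (use b in auto)
      moreover have "norm (P j ?z0) \<le> K / R ^ j"
        using K [of j] \<rho> by (simp add: field_simps)
      ultimately have "norm (?b j * P j ?z0) \<le> (\<Prod>i=1..j. real (i + m)) * (K / R ^ j)"
        unfolding norm_mult by (intro mult_mono) (auto intro: prod_nonneg)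
      then have "norm (a j) \<le> (\<Prod>i=1..j. real (i + m)) * (K / R ^ j) / fact j"
        unfolding a_def chain [OF T(3)] norm_divide norm_fact by (intro divide_right_mono) auto
      also have "\<dots> = (\<Prod>i=1..j. real (i + m) / real i) * K / R ^ j"
        by (simp add: prod_dividef fact_prod field_simps)
      finally have "norm (a j) * norm w ^ j \<le> (\<Prod>i=1..j. real (i + m) / real i) * K / R ^ j * norm w ^ j"
        by (intro mult_right_mono) auto
      then show ?thesis
        by (simp add: h_def norm_mult norm_power power_divide mult_ac)
    qed
    have "summable h"
    proof -
      define q where "q = norm w / R"
      have q: "0 \<le> q" "q < 1" using w \<rho> by (auto simp: q_def)
      define c where "c = (1 + q) / 2"
      have c: "q < c" "c < 1" using q by (auto simp: c_def)
      \<comment> \<open>The quotients of consecutive terms of \<open>h\<close> tend to \<open>q\<close>, so they are below \<open>c\<close> from \<open>N\<close> on.\<close>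
      obtain N :: nat where N: "real m * q / (c - q) \<le> real N" using real_arch_simple by blast
      show ?thesis
      proof (rule summable_ratio_test [OF \<open>c < 1\<close>, of N])
        fix n assume "N \<le> n"
        then have "real m * q / (c - q) \<le> real (Suc n)" using N by linarith
        then have "real (Suc n + m) / real (Suc n) * q \<le> c"
          using c by (simp add: field_simps)
        then have "real (Suc n + m) / real (Suc n) * q * h n \<le> c * h n"
          using h_nonneg by (intro mult_right_mono)
        moreover have "h (Suc n) = real (Suc n + m) / real (Suc n) * q * h n"
          by (simp add: h_def q_def)
        ultimately show "norm (h (Suc n)) \<le> c * norm (h n)"
          using h_nonneg [of n] h_nonneg [of "Suc n"] by (simp only: real_norm_def abs_of_nonneg)
      qed
    qed
    then show ?thesis
      by (rule summable_comparison_test' [of _ 0]) (use le in auto)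
  qed
  \<comment> \<open>The sum of the Taylor series agrees with \<open>P 0\<close> near \<open>?z0\<close> and is holomorphic in the large disc.\<close>
  define g where "g z = (\<Sum>j. a j * (z - ?z0) ^ j)" for z
  have g_sums: "(\<lambda>j. a j * (z - ?z0) ^ j) sums g z" if "norm (z - ?z0) < R" for z
    using a_summable [OF that] by (simp add: g_def summable_sums)
  have g_hol: "g holomorphic_on ball ?z0 R"
    by (rule power_series_holomorphic [where a = a]) (use g_sums in \<open>auto simp: dist_norm norm_minus_commute\<close>)
  obtain \<epsilon> where \<epsilon>: "\<epsilon> > 0" "ball ?z0 \<epsilon> \<subseteq> U" using U T open_contains_ball by metis
  obtain \<epsilon>' where \<epsilon>': "\<epsilon>' > 0" "ball t0 \<epsilon>' \<subseteq> T" using T open_contains_ball by metis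
  obtain \<sigma> where \<sigma>: "\<rho> < \<sigma>" "\<sigma> < R" using dense \<rho>(2) by blast
  define \<eta> where "\<eta> = Min {\<epsilon>, \<epsilon>', R, \<sigma> - \<rho>}"
  have \<eta>: "\<eta> > 0" "\<eta> \<le> \<epsilon>" "\<eta> \<le> \<epsilon>'" "\<eta> \<le> R" "\<eta> \<le> \<sigma> - \<rho>"
    using \<epsilon> \<epsilon>' \<sigma> \<rho> by (auto simp: \<eta>_def)
  have P_hol: "P 0 holomorphic_on ball ?z0 \<eta>"
    using U(2) by (rule holomorphic_on_subset) (use \<eta> \<epsilon> in auto)
  have gP: "P 0 z = g z" if z: "z \<in> ball ?z0 \<eta>" for z
  proof -
    have "(\<lambda>j. a j * (z - ?z0) ^ j) sums P 0 z"
      unfolding a_def by (rule holomorphic_power_series [OF P_hol z])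
    moreover have "norm (z - ?z0) < R"
      using z \<eta>(4) by (simp add: dist_norm norm_minus_commute)
    ultimately show ?thesis using g_sums sums_unique2 by blast
  qed
  have "continuous_on (cball ?z0 \<sigma>) g"
    by (rule continuous_on_subset [OF holomorphic_on_imp_continuous_on [OF g_hol]]) (use \<sigma> in auto)
  then have "bounded (g ` cball ?z0 \<sigma>)"
    by (intro compact_imp_bounded compact_continuous_image compact_cball)
  then obtain B where B: "\<And>z. z \<in> cball ?z0 \<sigma> \<Longrightarrow> norm (g z) \<le> B"
    unfolding bounded_iff by blast
  show ?thesis
  proof (rule that [OF \<eta>(1)])
    show inT: "t \<in> T" if "\<bar>t - t0\<bar> < \<eta>" for t
      using that \<eta>(3) \<epsilon>'(2) by (auto simp: dist_real_def subset_iff)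
    show "norm (P j (of_real t)) * \<rho> ^ j \<le> B" if t: "\<bar>t - t0\<bar> < \<eta>" for t j
    proof -
      let ?t = "complex_of_real t"
      have dist_t: "dist ?z0 ?t < \<eta>" using t by (simp add: dist_real_def abs_minus_commute)
      have sub: "cball ?t \<rho> \<subseteq> cball ?z0 \<sigma>"
      proof
        fix z assume "z \<in> cball ?t \<rho>"
        then show "z \<in> cball ?z0 \<sigma>"
          using dist_triangle [of ?z0 z ?t] dist_t \<eta>(5) by simp
      qed
      have "(deriv ^^ j) (P 0) ?t = (deriv ^^ j) g ?t"
        by (rule higher_deriv_transform_within_open [OF P_hol])
          (use gP dist_t \<eta>(4) in \<open>auto intro: holomorphic_on_subset [OF g_hol]\<close>)
      moreover have "norm ((deriv ^^ j) g ?t) \<le> fact j * B / \<rho> ^ j"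
      proof (rule Cauchy_inequality)
        have "cball ?t \<rho> \<subseteq> ball ?z0 R" using sub \<sigma> by (auto simp: subset_iff)
        then show "g holomorphic_on ball ?t \<rho>" "continuous_on (cball ?t \<rho>) g"
          using g_hol by (meson ball_subset_cball holomorphic_on_subset
              holomorphic_on_imp_continuous_on)+
        show "norm (g z) \<le> B" if "norm (?t - z) = \<rho>" for z
          using B sub that by (auto simp: dist_norm subset_iff)
      qed (rule \<rho>)
      ultimately have "norm (?b j) * norm (P j ?t) \<le> fact j * B / \<rho> ^ j"
        by (simp only: chain [OF inT [OF t]] flip: norm_mult)
      moreover have "fact j \<le> norm (?b j)"
      proof -
        have "fact j = (\<Prod>i=1..j. real i)" by (simp add: fact_prod)
        also have "\<dots> \<le> (\<Prod>i=1..j. norm (b i))"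
          by (intro prod_mono) (use b in auto)
        finally show ?thesis by (simp add: prod_norm)
      qed
      ultimately have "fact j * norm (P j ?t) \<le> fact j * (B / \<rho> ^ j)"
        using mult_right_mono [of "fact j" "norm (?b j)" "norm (P j ?t)"] by simp
      then have "norm (P j ?t) \<le> B / \<rho> ^ j"
        by (simp only: mult_le_cancel_left_pos fact_gt_zero)
      then show ?thesis
        using \<rho>(1) by (simp add: field_simps)
    qed
  qed
qed

section \<open>Vectors in the Clifford algebra\<close>
lemma norm_coeff_le: "norm (coeff x A) \<le> norm x"
  unfolding norm_clifford_def by (rule member_le_sum) auto

lemma bounded_linear_coeff: "bounded_linear (\<lambda>x. coeff x A)"
  by (rule bounded_linear_intro [where K = 1]) (auto simp: norm_coeff_le)

text \<open>
  Completeness makes the convergence and differentiation theorems for series available for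
  Clifford-valued functions.
\<close>
instance clifford :: ("{finite,linorder}") banach
proof
  fix X :: "nat \<Rightarrow> 'a clifford"
  assume X: "Cauchy X"
  have "Cauchy (\<lambda>n. coeff (X n) A)" for A
    by (rule bounded_linear.Cauchy [OF bounded_linear_coeff X])
  then obtain L where L: "\<And>A. (\<lambda>n. coeff (X n) A) \<longlonglongrightarrow> L A"
    unfolding Cauchy_convergent_iff convergent_def by metis
  have "(\<lambda>n. \<Sum>A\<in>UNIV. norm (coeff (X n) A - L A)) \<longlonglongrightarrow> (\<Sum>A\<in>UNIV. norm (L A - L A))"
    by (intro tendsto_intros L)
  then have "(\<lambda>n. norm (X n - Clifford L)) \<longlonglongrightarrow> 0"
    by (simp add: norm_clifford_def)
  then show "convergent X"
    unfolding convergent_def using LIM_zero_cancel tendsto_norm_zero_iff by blast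
qed

lemma norm_gen: "norm (gen i) = 1"
  by (simp add: norm_clifford_def gen_def if_distrib cong: if_cong)

lemma coeff_clifford_of_complex: "coeff (clifford_of_complex c) A = (if A = {} then c else 0)"
  by (simp add: clifford_of_complex_def)

lemma norm_clifford_of_complex: "norm (clifford_of_complex c) = norm c"
  by (simp add: norm_clifford_def coeff_clifford_of_complex if_distrib cong: if_cong)

lemma bounded_linear_clifford_of_complex: "bounded_linear clifford_of_complex"
  by (rule bounded_linear_intro [where K = 1])
    (auto simp: norm_clifford_of_complex coeff_clifford_of_complex intro: clifford_eqI)

lemma coeff_mult_clifford_of_complex: "coeff (x * clifford_of_complex c) S = coeff x S * c"
proof -
  have "(sym_diff A S = {}) = (A = S)" for A by blast
  then show ?thesis
    by (simp add: coeff_mult coeff_clifford_of_complex if_distrib if_distribR cong: if_cong)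
qed

lemma clifford_combination_anticommutator:
  fixes g :: "'i::finite \<Rightarrow> 'n::{finite,linorder}" and u v :: "real ^ 'i"
  assumes "inj g"
  shows "(\<Sum>j\<in>UNIV. (u $ j) *\<^sub>R gen (g j)) * (\<Sum>j\<in>UNIV. (v $ j) *\<^sub>R gen (g j)) +
      (\<Sum>j\<in>UNIV. (v $ j) *\<^sub>R gen (g j)) * (\<Sum>j\<in>UNIV. (u $ j) *\<^sub>R gen (g j)) =
      (- 2 * (u \<bullet> v)) *\<^sub>R 1"
proof -
  have "(\<Sum>j\<in>UNIV. (u $ j) *\<^sub>R gen (g j)) * (\<Sum>j\<in>UNIV. (v $ j) *\<^sub>R gen (g j)) +
      (\<Sum>j\<in>UNIV. (v $ j) *\<^sub>R gen (g j)) * (\<Sum>j\<in>UNIV. (u $ j) *\<^sub>R gen (g j)) =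
      (\<Sum>j\<in>UNIV. \<Sum>k\<in>UNIV. (u $ j * v $ k) *\<^sub>R (gen (g j) * gen (g k))) +
      (\<Sum>k\<in>UNIV. \<Sum>j\<in>UNIV. (v $ k * u $ j) *\<^sub>R (gen (g k) * gen (g j)))"
    by (simp add: sum_product mult.commute)
  also have "(\<Sum>k\<in>UNIV. \<Sum>j\<in>UNIV. (v $ k * u $ j) *\<^sub>R (gen (g k) * gen (g j))) =
      (\<Sum>j\<in>UNIV. \<Sum>k\<in>UNIV. (u $ j * v $ k) *\<^sub>R (gen (g k) * gen (g j)))"
    by (subst sum.swap) (simp add: mult.commute)
  also have "(\<Sum>j\<in>UNIV. \<Sum>k\<in>UNIV. (u $ j * v $ k) *\<^sub>R (gen (g j) * gen (g k))) +
      (\<Sum>j\<in>UNIV. \<Sum>k\<in>UNIV. (u $ j * v $ k) *\<^sub>R (gen (g k) * gen (g j))) =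
      (\<Sum>j\<in>UNIV. \<Sum>k\<in>UNIV. (u $ j * v $ k) *\<^sub>R (gen (g j) * gen (g k) + gen (g k) * gen (g j)))"
    by (simp add: sum.distrib scaleR_add_right)
  also have "\<dots> = (\<Sum>j\<in>UNIV. \<Sum>k\<in>UNIV. if j = k then (- 2 * (u $ j * v $ j)) *\<^sub>R 1 else 0)"
  proof (intro sum.cong refl)
    fix j k
    have two: "- 2 = (- 2) *\<^sub>R (1 :: 'n clifford)"
      by (simp add: scaleR_conv_of_real)
    show "(u $ j * v $ k) *\<^sub>R (gen (g j) * gen (g k) + gen (g k) * gen (g j)) =
        (if j = k then (- 2 * (u $ j * v $ j)) *\<^sub>R 1 else 0)"
    proof (cases "j = k")
      case True
      then show ?thesis
        by (simp only: gen_anticommute refl if_True two scaleR_scaleR mult.commute)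
    next
      case False
      then show ?thesis
        using \<open>inj g\<close> by (simp add: gen_anticommute inj_eq)
    qed
  qed
  also have "\<dots> = (\<Sum>j\<in>UNIV. (- 2 * (u $ j * v $ j)) *\<^sub>R 1)"
    by simp
  also have "\<dots> = (- 2 * (u \<bullet> v)) *\<^sub>R 1"
    by (simp only: inner_vec_def inner_real_def sum_distrib_left scaleR_sum_left)
  finally show ?thesis .
qed

lemma vecx_anticommutator: "vecx u * vecx v + vecx v * vecx u = (- 2 * (u \<bullet> v)) *\<^sub>R 1"
  unfolding vecx_def by (rule clifford_combination_anticommutator) simp

lemma vecy_anticommutator: "vecy u * vecy v + vecy v * vecy u = (- 2 * (u \<bullet> v)) *\<^sub>R 1"
  unfolding vecy_def by (rule clifford_combination_anticommutator) simp

lemma vecx_square: "vecx x * vecx x = - (norm x ^ 2) *\<^sub>R 1"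
proof -
  have "2 *\<^sub>R (vecx x * vecx x) = 2 *\<^sub>R (- (norm x ^ 2) *\<^sub>R 1)"
    using vecx_anticommutator [of x x] by (simp add: scaleR_2 power2_norm_eq_inner)
  then show ?thesis by (simp only: scaleR_cancel_left) simp
qed

lemma vecy_square: "vecy y * vecy y = - (norm y ^ 2) *\<^sub>R 1"
proof -
  have "2 *\<^sub>R (vecy y * vecy y) = 2 *\<^sub>R (- (norm y ^ 2) *\<^sub>R 1)"
    using vecy_anticommutator [of y y] by (simp add: scaleR_2 power2_norm_eq_inner)
  then show ?thesis by (simp only: scaleR_cancel_left) simp
qed

lemma vecy_vecx: "vecy y * vecx x = - (vecx x * vecy y)"
proof -
  have "gen (Inr k) * gen (Inl j) = - (gen (Inl j) * gen (Inr k) :: ('a + 'b) clifford)"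
    for k :: 'b and j :: 'a
    using gen_anticommute [of "Inr k" "Inl j"] by (simp add: eq_neg_iff_add_eq_0)
  then have "vecy y * vecx x = (\<Sum>k\<in>UNIV. \<Sum>j\<in>UNIV. - ((x $ j * y $ k) *\<^sub>R (gen (Inl j) * gen (Inr k))))"
    by (simp add: vecx_def vecy_def sum_product mult.commute)
  also have "\<dots> = - (vecx x * vecy y)"
    by (subst sum.swap) (simp add: vecx_def vecy_def sum_product sum_negf mult.commute)
  finally show ?thesis .
qed

lemma vecy_vecx_power: "vecy y * vecx x ^ j = (- 1) ^ j * (vecx x ^ j * vecy y)"
proof (induction j)
  case (Suc j)
  have "vecy y * vecx x ^ Suc j = - (vecx x * (vecy y * vecx x ^ j))"
    by (simp add: vecy_vecx flip: mult.assoc)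
  also have "\<dots> = - (vecx x * ((- 1) ^ j * (vecx x ^ j * vecy y)))"
    by (simp only: Suc)
  also have "\<dots> = (- 1) ^ Suc j * (vecx x ^ Suc j * vecy y)"
    by (cases "even j") (simp_all add: mult.assoc)
  finally show ?case .
qed simp

lemma vecx_add: "vecx (x + y) = vecx x + vecx y"
  by (simp add: vecx_def scaleR_add_left sum.distrib)

lemma vecx_scaleR: "vecx (c *\<^sub>R x) = c *\<^sub>R vecx x"
  by (simp add: vecx_def scaleR_sum_right)

lemma vecx_axis: "vecx (axis i 1) = gen (Inl i)"
  by (simp add: vecx_def axis_def if_distrib if_distribR cong: if_cong)

lemma norm_vecx_le:
  fixes x :: "real ^ 'p::{finite,linorder}"
  shows "norm (vecx x) \<le> real CARD('p) * norm x"
proof -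
  have "norm (vecx x) \<le> (\<Sum>j\<in>(UNIV :: 'p set). norm x)"
    unfolding vecx_def by (intro sum_norm_le) (simp add: norm_gen component_le_norm_cart)
  then show ?thesis by simp
qed

lemma power_add_2: "x ^ (j + 2) = x * x * x ^ j" for x :: "'a::monoid_mult"
  by (simp add: mult.assoc)

text \<open>
  The factor \<open>CARD('p)\<close> compares the sum norm with the Euclidean norm. It occurs only once, however
  large \<open>j\<close> is, because even powers of a vector are real: this is why the series has the radius of
  convergence measured by the Euclidean norm.
\<close>
lemma norm_vecx_power_le:
  fixes x :: "real ^ 'p::{finite,linorder}"
  assumes "norm x \<le> \<rho>"
  shows "norm (vecx x ^ j :: ('p + 'q::{finite,linorder}) clifford) \<le> real CARD('p) * \<rho> ^ j"
proof (induction j rule: nat_induct2)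
  case 0
  then show ?case by (simp add: Suc_le_eq)
next
  case 1
  have "norm (vecx x) \<le> real CARD('p) * norm x" by (rule norm_vecx_le)
  also have "\<dots> \<le> real CARD('p) * \<rho>" using assms by (intro mult_left_mono) auto
  finally show ?case by simp
next
  case (step j)
  have "norm (vecx x ^ (j + 2) :: ('p + 'q) clifford) = norm x ^ 2 * norm (vecx x ^ j :: ('p + 'q) clifford)"
    unfolding power_add_2 vecx_square by simp
  also have "\<dots> \<le> \<rho> ^ 2 * (real CARD('p) * \<rho> ^ j)"
    using step assms by (intro mult_mono power_mono) auto
  finally show ?case
    by (simp only: power_add power2_eq_square ac_simps)
qed

lemma power_mult_self: "v ^ j * v ^ j = (v * v) ^ j" for v :: "'a::monoid_mult"
  by (simp only: power2_eq_square [symmetric] power_mult [symmetric] mult.commute)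

lemma vecx_power_double: "vecx x ^ j * vecx x ^ j = (- (norm x ^ 2)) ^ j *\<^sub>R 1"
  unfolding power_mult_self vecx_square scaleR_power power_one ..

text \<open>
  Multiplying \<open>x\<^sup>j W\<close> by \<open>x\<^sup>j\<close> once more gives \<open>W\<close> up to the real factor \<open>\<plusminus>|x|\<^sup>2\<^sup>j\<close>. So bounds on the terms
  of a series pass to its coefficients.
\<close>
lemma norm_le_norm_vecx_power_mult:
  fixes x :: "real ^ 'p::{finite,linorder}"
    and W :: "('p + 'q::{finite,linorder}) clifford"
  shows "norm x ^ j * norm W \<le> real CARD('p) * norm (vecx x ^ j * W)"
proof (cases "norm x ^ j = 0")
  case False
  then have pos: "norm x ^ j > 0"
    using zero_le_power [OF norm_ge_zero, of x j] by linarith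
  have "vecx x ^ j * (vecx x ^ j * W) = (- (norm x ^ 2)) ^ j *\<^sub>R W"
    unfolding mult.assoc [symmetric] vecx_power_double by simp
  then have "norm (vecx x ^ j * (vecx x ^ j * W)) = (norm x ^ 2) ^ j * norm W"
    by (simp add: power_abs)
  moreover have "norm (vecx x ^ j * (vecx x ^ j * W)) \<le>
      norm (vecx x ^ j :: ('p + 'q) clifford) * norm (vecx x ^ j * W)"
    by (rule norm_mult_ineq)
  moreover have "norm (vecx x ^ j :: ('p + 'q) clifford) * norm (vecx x ^ j * W) \<le>
      real CARD('p) * norm x ^ j * norm (vecx x ^ j * W)"
    by (rule mult_right_mono [OF norm_vecx_power_le [OF order_refl] norm_ge_zero])
  ultimately have "(norm x ^ 2) ^ j * norm W \<le> real CARD('p) * norm x ^ j * norm (vecx x ^ j * W)"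
    by linarith
  then have "norm x ^ j * (norm x ^ j * norm W) \<le> norm x ^ j * (real CARD('p) * norm (vecx x ^ j * W))"
    unfolding power2_eq_square power_mult_distrib by (simp only: ac_simps)
  then show ?thesis using pos by (rule mult_left_le_imp_le)
next
  case True
  then show ?thesis by (simp only: mult_zero_left) simp
qed

section \<open>The Dirac operators on power series and on plane waves\<close>

text \<open>
  The derivative of \<open>v\<^sup>j\<close> in the direction \<open>e\<close>, which need not commute with \<open>v\<close>.
\<close>
primrec power_deriv :: "'a::real_normed_algebra_1 \<Rightarrow> 'a \<Rightarrow> nat \<Rightarrow> 'a" where
  "power_deriv e v 0 = 0"
| "power_deriv e v (Suc j) = e * v ^ j + v * power_deriv e v j"

lemma has_vector_derivative_power_line:
  fixes e v :: "'a::real_normed_algebra_1"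
  shows "((\<lambda>h. (v + h *\<^sub>R e) ^ j) has_vector_derivative power_deriv e (v + h *\<^sub>R e) j) (at h)"
proof (induction j)
  case (Suc j)
  have "((\<lambda>h. v + h *\<^sub>R e) has_vector_derivative e) (at h)"
    by (auto intro!: derivative_eq_intros)
  from has_vector_derivative_mult [OF this Suc] show ?case
    by (simp add: add.commute)
qed simp

text \<open>
  The recursion for \<open>power_deriv\<close> loses a constant factor of the sum norm in every step. Two steps at
  once do not, as \<open>e v + v e\<close> and \<open>v\<^sup>2\<close> are real.
\<close>
lemma norm_power_deriv_vecx_le:
  fixes x :: "real ^ 'p::{finite,linorder}"
  assumes "norm x \<le> \<rho>" "0 < \<rho>"
  shows "norm (power_deriv (gen (Inl i)) (vecx x) j :: ('p + 'q::{finite,linorder}) clifford) * \<rho> \<le> 2 * real CARD('p) * real j * \<rho> ^ j"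
proof (induction j rule: nat_induct2)
  case 1
  have "1 \<le> 2 * real CARD('p)"
    using zero_less_card_finite [where 'a = 'p] by linarith
  then show ?case using assms(2) by (simp add: norm_gen)
next
  case (step j)
  let ?e = "gen (Inl i) :: ('p + 'q) clifford" and ?v = "vecx x :: ('p + 'q) clifford"
  have "?e * ?v + ?v * ?e = (- 2 * x $ i) *\<^sub>R 1"
    using vecx_anticommutator [of "axis i 1" x] by (simp add: vecx_axis inner_axis')
  moreover have "power_deriv ?e ?v (j + 2) =
      (?e * ?v + ?v * ?e) * ?v ^ j + ?v * ?v * power_deriv ?e ?v j"
    by (simp add: algebra_simps)
  ultimately have "power_deriv ?e ?v (j + 2) =
      (- 2 * x $ i) *\<^sub>R ?v ^ j + (- (norm x ^ 2)) *\<^sub>R power_deriv ?e ?v j"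
    by (simp add: vecx_square)
  then have "norm (power_deriv ?e ?v (j + 2)) \<le>
      2 * \<bar>x $ i\<bar> * norm (?v ^ j) + norm x ^ 2 * norm (power_deriv ?e ?v j)"
    by (simp only:) (rule order_trans [OF norm_triangle_ineq], simp add: abs_mult)
  also have "\<dots> \<le> 2 * \<rho> * (real CARD('p) * \<rho> ^ j) + \<rho> ^ 2 * norm (power_deriv ?e ?v j)"
    using assms component_le_norm_cart [of x i]
    by (intro add_mono mult_mono power_mono norm_vecx_power_le) auto
  finally have "norm (power_deriv ?e ?v (j + 2)) * \<rho> \<le>
      (2 * \<rho> * (real CARD('p) * \<rho> ^ j) + \<rho> ^ 2 * norm (power_deriv ?e ?v j)) * \<rho>"
    using assms(2) by (intro mult_right_mono) auto
  also have "\<dots> = 2 * real CARD('p) * \<rho> ^ (j + 2) + \<rho> ^ 2 * (norm (power_deriv ?e ?v j) * \<rho>)"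
    by (simp add: algebra_simps power2_eq_square)
  also have "\<dots> \<le> 2 * real CARD('p) * \<rho> ^ (j + 2) + \<rho> ^ 2 * (2 * real CARD('p) * real j * \<rho> ^ j)"
    by (intro add_left_mono mult_left_mono step.IH) auto
  also have "\<dots> = 2 * real CARD('p) * (real j + 1) * \<rho> ^ (j + 2)"
    by (simp add: algebra_simps power2_eq_square)
  also have "\<dots> \<le> 2 * real CARD('p) * real (j + 2) * \<rho> ^ (j + 2)"
    using assms(2) by (intro mult_right_mono mult_left_mono) auto
  finally show ?case .
qed simp

text \<open>
  Euler's identity for the homogeneous function \<open>x\<^sup>j\<close>.
\<close>
lemma power_deriv_euler:
  fixes x :: "real ^ 'p::{finite,linorder}"
  shows "(\<Sum>i\<in>UNIV. (x $ i) *\<^sub>R power_deriv (gen (Inl i)) (vecx x) j) =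
    (real j *\<^sub>R vecx x ^ j :: ('p + 'q::{finite,linorder}) clifford)"
proof (induction j)
  case (Suc j)
  let ?e = "\<lambda>i. gen (Inl i) :: ('p + 'q) clifford" and ?v = "vecx x :: ('p + 'q) clifford"
  have "(\<Sum>i\<in>UNIV. (x $ i) *\<^sub>R power_deriv (?e i) ?v (Suc j)) =
      (\<Sum>i\<in>UNIV. (x $ i) *\<^sub>R ?e i) * ?v ^ j + ?v * (\<Sum>i\<in>UNIV. (x $ i) *\<^sub>R power_deriv (?e i) ?v j)"
    by (simp add: sum.distrib scaleR_add_right sum_distrib_left sum_distrib_right)
  also have "\<dots> = ?v ^ Suc j + ?v * (real j *\<^sub>R ?v ^ j)"
    unfolding Suc by (simp flip: vecx_def)
  finally show ?case by (simp add: scaleR_add_left)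
qed simp

lemma gen_square: "gen i * gen i = - 1"
proof -
  have "2 *\<^sub>R (gen i * gen i) = 2 *\<^sub>R (- 1)"
    using gen_anticommute [of i i] by (simp add: scaleR_2)
  then show ?thesis by (simp only: scaleR_cancel_left) simp
qed

definition real_beta :: "nat \<Rightarrow> nat \<Rightarrow> real" where
  "real_beta p j = (if even j then - real j else - (real j + real p - 1))"

lemma beta_eq_of_real: "beta p j = of_real (real_beta p j)"
  by (simp add: beta_def real_beta_def)

text \<open>
  Moving the generators past \<open>x\<close> with \<open>e\<^sub>i x = - x e\<^sub>i - 2 x\<^sub>i\<close> and using Euler's identity gives the
  recursion \<open>\<beta>\<^sub>j\<^sub>+\<^sub>1 = - p - 2 j - \<beta>\<^sub>j\<close>, which the closed form of \<open>\<beta>\<close> solves.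
\<close>
lemma dirac_vecx_power:
  fixes x :: "real ^ 'p::{finite,linorder}"
  shows "(\<Sum>i\<in>UNIV. gen (Inl i) * power_deriv (gen (Inl i)) (vecx x) (Suc j)) =
    (real_beta CARD('p) (Suc j) *\<^sub>R vecx x ^ j :: ('p + 'q::{finite,linorder}) clifford)"
proof (induction j)
  case 0
  then show ?case by (simp add: gen_square real_beta_def scaleR_conv_of_real)
next
  case (Suc j)
  let ?e = "\<lambda>i. gen (Inl i) :: ('p + 'q) clifford" and ?v = "vecx x :: ('p + 'q) clifford"
  let ?D = "\<lambda>i. power_deriv (?e i) ?v (Suc j)"
  have anti: "?e i * ?v = - (?v * ?e i) - (2 * x $ i) *\<^sub>R 1" for i
    using vecx_anticommutator [of "axis i 1" x]
    by (simp add: vecx_axis inner_axis' algebra_simps eq_neg_iff_add_eq_0 flip: add_eq_0_iff)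
  have "(\<Sum>i\<in>UNIV. ?e i * power_deriv (?e i) ?v (Suc (Suc j))) =
      (\<Sum>i\<in>UNIV. (?e i * ?e i) * ?v ^ Suc j + (?e i * ?v) * ?D i)"
    by (simp only: power_deriv.simps(2) [of _ _ "Suc j"] distrib_left mult.assoc)
  also have "\<dots> = (\<Sum>i\<in>(UNIV :: 'p set). - (?v ^ Suc j)) - ?v * (\<Sum>i\<in>UNIV. ?e i * ?D i)
      - 2 *\<^sub>R (\<Sum>i\<in>UNIV. (x $ i) *\<^sub>R ?D i)"
    unfolding gen_square anti sum_distrib_left scaleR_sum_right sum_subtractf [symmetric]
    by (intro sum.cong refl) (simp add: left_diff_distrib mult.assoc del: power_deriv.simps power_Suc)
  also have "\<dots> = - real CARD('p) *\<^sub>R ?v ^ Suc j - real_beta CARD('p) (Suc j) *\<^sub>R ?v ^ Suc j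
      - (2 * real (Suc j)) *\<^sub>R ?v ^ Suc j"
    unfolding Suc.IH power_deriv_euler
    by (simp add: sum_constant_scaleR del: sum_constant of_nat_Suc)
  also have "\<dots> = (- real CARD('p) - real_beta CARD('p) (Suc j) - 2 * real (Suc j)) *\<^sub>R ?v ^ Suc j"
    by (simp only: scaleR_diff_left)
  also have "- real CARD('p) - real_beta CARD('p) (Suc j) - 2 * real (Suc j) = real_beta CARD('p) (Suc (Suc j))"
    by (simp add: real_beta_def)
  finally show ?case .
qed

text \<open>
  The bound on the coefficients at the radius \<open>R\<close> dominates the differentiated series on a ball of
  smaller radius \<open>\<rho>\<close>, so the partial derivatives may be taken term by term.
\<close>
lemma dirac_x_power_series:
  fixes x :: "real ^ 'p::{finite,linorder}" and y :: "real ^ 'q::{finite,linorder}"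
    and F :: "(real ^ 'p::_) \<times> (real ^ 'q::_) \<Rightarrow> ('p + 'q) clifford"
  assumes K: "\<And>j. norm (W j) * R ^ j \<le> K" and x: "norm x < R"
    and "0 < \<epsilon>" and F: "\<And>x'. dist x' x < \<epsilon> \<Longrightarrow> (\<lambda>j. vecx x' ^ j * W j) sums F (x', y)"
  shows "(\<lambda>h. F (x + h *\<^sub>R axis i 1, y)) differentiable (at 0)"
    and "dirac_x F x y = (\<Sum>j. real_beta CARD('p) (Suc j) *\<^sub>R (vecx x ^ j * W (Suc j)))"
proof -
  let ?e = "\<lambda>i. gen (Inl i) :: ('p + 'q) clifford" and ?v = "vecx x :: ('p + 'q) clifford"
  obtain \<rho> where \<rho>: "norm x < \<rho>" "\<rho> < R" using dense x by blast
  have "0 < \<rho>" "0 < R" using \<rho> norm_ge_zero [of x] by linarith+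
  have line: "vecx (x + h *\<^sub>R axis i 1) = ?v + h *\<^sub>R ?e i" for h i
    by (simp add: vecx_add vecx_scaleR vecx_axis)
  define \<delta> where "\<delta> = min \<epsilon> (\<rho> - norm x)"
  have \<delta>: "0 < \<delta>" "\<delta> \<le> \<epsilon>" "\<delta> \<le> \<rho> - norm x" using \<open>0 < \<epsilon>\<close> \<rho> by (auto simp: \<delta>_def)
  define M where "M j = 2 * real CARD('p) / \<rho> * K * (real (j + 0) * (\<rho> / R) ^ j)" for j
  have M: "summable M"
    unfolding M_def using \<rho> \<open>0 < \<rho>\<close> \<open>0 < R\<close>
    by (intro summable_mult summable_linear_times_geometric) auto
  have bound: "norm (power_deriv (?e i) (vecx x') j * W j) \<le> M j" if "norm x' \<le> \<rho>" for i j x'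
  proof -
    have "norm (power_deriv (?e i) (vecx x') j) \<le> 2 * real CARD('p) * real j * \<rho> ^ j / \<rho>"
      using norm_power_deriv_vecx_le [OF that \<open>0 < \<rho>\<close>, where 'q = 'q, of i j] \<open>0 < \<rho>\<close>
      by (simp add: pos_le_divide_eq)
    moreover have "norm (W j) \<le> K / R ^ j"
      using K [of j] \<open>0 < R\<close> by (simp add: pos_le_divide_eq)
    ultimately have "norm (power_deriv (?e i) (vecx x') j) * norm (W j) \<le>
        (2 * real CARD('p) * real j * \<rho> ^ j / \<rho>) * (K / R ^ j)"
      using \<open>0 < \<rho>\<close> by (intro mult_mono) auto
    also have "\<dots> = M j"
      by (simp add: M_def power_divide)
    finally show ?thesis using norm_mult_ineq order_trans by blast
  qed
  have deriv: "((\<lambda>h. F (x + h *\<^sub>R axis i 1, y)) has_vector_derivative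
      (\<Sum>j. power_deriv (?e i) ?v j * W j)) (at 0)" for i
  proof -
    have "((\<lambda>h. \<Sum>j. vecx (x + h *\<^sub>R axis i 1) ^ j * W j) has_vector_derivative
        (\<Sum>j. power_deriv (?e i) (vecx (x + 0 *\<^sub>R axis i 1)) j * W j)) (at 0)"
    proof (rule termwise_vector_derivative [OF \<delta>(1) _ _ M])
      fix j and h :: real
      assume h: "\<bar>h - 0\<bar> < \<delta>"
      show "((\<lambda>h. vecx (x + h *\<^sub>R axis i 1) ^ j * W j) has_vector_derivative
          power_deriv (?e i) (vecx (x + h *\<^sub>R axis i 1)) j * W j) (at h)"
        unfolding line by (intro has_vector_derivative_mult_left has_vector_derivative_power_line)
      have "norm (x + h *\<^sub>R axis i 1) \<le> norm x + \<bar>h\<bar>"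
        using norm_triangle_ineq [of x "h *\<^sub>R axis i 1"] by (simp add: norm_axis_1)
      then show "norm (power_deriv (?e i) (vecx (x + h *\<^sub>R axis i 1)) j * W j) \<le> M j"
        using h \<delta> by (intro bound) auto
    next
      show "summable (\<lambda>j. vecx (x + 0 *\<^sub>R axis i 1) ^ j * W j)"
        using F [of x] \<open>0 < \<epsilon>\<close> by (auto simp: sums_iff)
    qed
    then have "((\<lambda>h. \<Sum>j. vecx (x + h *\<^sub>R axis i 1) ^ j * W j) has_vector_derivative
        (\<Sum>j. power_deriv (?e i) ?v j * W j)) (at 0)"
      by simp
    then show ?thesis
      by (rule has_vector_derivative_transform_within_open [of _ _ _ "ball 0 \<epsilon>"])
        (use F \<open>0 < \<epsilon>\<close> in \<open>auto simp: sums_iff dist_norm norm_axis_1\<close>)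
  qed
  then show "(\<lambda>h. F (x + h *\<^sub>R axis i 1, y)) differentiable (at 0)"
    by (rule differentiableI_vector)
  have sm: "summable (\<lambda>j. power_deriv (?e i) ?v j * W j)" for i
    by (rule summable_comparison_test' [OF M, of 0]) (use bound \<rho> in auto)
  have "dirac_x F x y = (\<Sum>i\<in>UNIV. ?e i * (\<Sum>j. power_deriv (?e i) ?v j * W j))"
    by (simp add: dirac_x_def vector_derivative_at [OF deriv])
  also have "\<dots> = (\<Sum>i\<in>UNIV. \<Sum>j. ?e i * (power_deriv (?e i) ?v j * W j))"
    by (simp add: suminf_mult sm)
  also have "\<dots> = (\<Sum>j. \<Sum>i\<in>UNIV. ?e i * (power_deriv (?e i) ?v j * W j))"
    by (rule suminf_sum [symmetric]) (intro summable_mult sm)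
  also have "\<dots> = (\<Sum>j. (\<Sum>i\<in>UNIV. ?e i * power_deriv (?e i) ?v j) * W j)"
    by (simp add: sum_distrib_right mult.assoc)
  also have "\<dots> = (\<Sum>j. (\<Sum>i\<in>UNIV. ?e i * power_deriv (?e i) ?v (Suc j)) * W (Suc j))"
  proof (subst suminf_split_head)
    have "summable (\<lambda>j. \<Sum>i\<in>UNIV. ?e i * (power_deriv (?e i) ?v j * W j))"
      by (intro summable_sum summable_mult sm)
    then show "summable (\<lambda>j. (\<Sum>i\<in>UNIV. ?e i * power_deriv (?e i) ?v j) * W j)"
      by (simp add: sum_distrib_right mult.assoc)
  qed (simp del: power_deriv.simps(2))
  also have "\<dots> = (\<Sum>j. real_beta CARD('p) (Suc j) *\<^sub>R (vecx x ^ j * W (Suc j)))"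
    by (simp only: dirac_vecx_power mult_scaleR_left)
  finally show "dirac_x F x y = (\<Sum>j. real_beta CARD('p) (Suc j) *\<^sub>R (vecx x ^ j * W (Suc j)))" .
qed

lemma has_vector_derivative_plane_wave:
  fixes F :: "(real ^ 'p::{finite,linorder}) \<times> (real ^ 'q::{finite,linorder}) \<Rightarrow> ('p + 'q) clifford"
  assumes f: "(f has_vector_derivative f') (at (y \<bullet> s))"
    and "0 < \<epsilon>" and F: "\<And>y'. dist y' y < \<epsilon> \<Longrightarrow> F (x, y') = f (y' \<bullet> s)"
  shows "((\<lambda>h. F (x, y + h *\<^sub>R axis i 1)) has_vector_derivative (s $ i) *\<^sub>R f') (at 0)"
proof -
  have "((\<lambda>h. y \<bullet> s + h * s $ i) has_vector_derivative s $ i) (at 0)"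
    by (auto intro!: derivative_eq_intros)
  then have "(f \<circ> (\<lambda>h. y \<bullet> s + h * s $ i) has_vector_derivative (s $ i) *\<^sub>R f') (at 0)"
    by (rule vector_diff_chain_at) (use f in simp)
  then show ?thesis
    by (rule has_vector_derivative_transform_within_open [of _ _ _ "ball 0 \<epsilon>"])
      (use \<open>0 < \<epsilon>\<close> F in \<open>auto simp: dist_norm norm_axis_1 inner_add_left inner_axis'\<close>)
qed

lemma dirac_y_plane_wave:
  fixes F :: "(real ^ 'p::{finite,linorder}) \<times> (real ^ 'q::{finite,linorder}) \<Rightarrow> ('p + 'q) clifford"
  assumes "(f has_vector_derivative f') (at (y \<bullet> s))"
    and "0 < \<epsilon>" "\<And>y'. dist y' y < \<epsilon> \<Longrightarrow> F (x, y') = f (y' \<bullet> s)"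
  shows "dirac_y F x y = vecy s * f'"
  unfolding dirac_y_def vecy_def sum_distrib_right
  using vector_derivative_at [OF has_vector_derivative_plane_wave [OF assms]] by simp

text \<open>
  A coordinate direction \<open>i\<close> with \<open>s\<^sub>i \<noteq> 0\<close> moves \<open>\<langle>y, s\<rangle>\<close> at constant speed, so differentiability
  of \<open>F\<close> in \<open>y\<^sub>i\<close> is differentiability of the profile.
\<close>
lemma plane_wave_profile_differentiable:
  fixes F :: "(real ^ 'p::{finite,linorder}) \<times> (real ^ 'q::{finite,linorder}) \<Rightarrow> ('p + 'q) clifford"
  assumes "s \<noteq> 0" and diff: "\<And>i. (\<lambda>h. F (x, y + h *\<^sub>R axis i 1)) differentiable (at (0::real))"
    and "0 < \<epsilon>" and F: "\<And>y'. dist y' y < \<epsilon> \<Longrightarrow> F (x, y') = f (y' \<bullet> s)"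
  obtains f' where "(f has_vector_derivative f') (at (y \<bullet> s))"
proof -
  obtain i where i: "s $ i \<noteq> 0" using \<open>s \<noteq> 0\<close> by (auto simp: vec_eq_iff)
  let ?h = "\<lambda>t. (t - y \<bullet> s) / s $ i"
  obtain D where D: "((\<lambda>h. F (x, y + h *\<^sub>R axis i 1)) has_vector_derivative D) (at 0)"
    using diff vector_derivative_works by blast
  have "(?h has_vector_derivative inverse (s $ i)) (at (y \<bullet> s))"
    using i by (auto intro!: derivative_eq_intros simp: field_simps
        simp flip: has_real_derivative_iff_has_vector_derivative)
  then have "((\<lambda>h. F (x, y + h *\<^sub>R axis i 1)) \<circ> ?h has_vector_derivative inverse (s $ i) *\<^sub>R D) (at (y \<bullet> s))"
    by (rule vector_diff_chain_at) (use D in simp)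
  then have "(f has_vector_derivative inverse (s $ i) *\<^sub>R D) (at (y \<bullet> s))"
  proof (rule has_vector_derivative_transform_within_open [of _ _ _ "ball (y \<bullet> s) (\<epsilon> * \<bar>s $ i\<bar>)"])
    fix t assume "t \<in> ball (y \<bullet> s) (\<epsilon> * \<bar>s $ i\<bar>)"
    then have "\<bar>t - y \<bullet> s\<bar> / \<bar>s $ i\<bar> < \<epsilon>"
      using i by (simp add: dist_real_def abs_minus_commute field_simps)
    then show "((\<lambda>h. F (x, y + h *\<^sub>R axis i 1)) \<circ> ?h) t = f t"
      using F [of "y + ?h t *\<^sub>R axis i 1"] i
      by (simp add: dist_norm norm_axis_1 abs_divide inner_add_left inner_axis')
  qed (use i \<open>0 < \<epsilon>\<close> in auto)
  then show ?thesis by (rule that)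
qed

section \<open>Coefficients of a plane wave\<close>
definition wave_coeff :: "real ^ 'q::{finite,linorder} \<Rightarrow> complex \<Rightarrow> complex \<Rightarrow> ('p::{finite,linorder} + 'q) clifford" where
  "wave_coeff s c d = clifford_of_complex c + vecy s * clifford_of_complex d"

text \<open>
  The component along \<open>1\<close> recovers \<open>c\<close>. Multiplication by \<open>s\<close> exchanges the two entries up to sign, so
  \<open>d\<close> is recovered in the same way.
\<close>
lemma coeff_wave_coeff_empty: "coeff (wave_coeff s c d) {} = c"
proof -
  have sum: "coeff (sum f A) S = (\<Sum>i\<in>A. coeff (f i) S)"
    for f :: "'b \<Rightarrow> ('c::{finite,linorder} + 'b::{finite,linorder}) clifford" and A S
    by (induction A rule: infinite_finite_induct) auto
  show ?thesis
    by (simp add: wave_coeff_def coeff_mult_clifford_of_complex coeff_clifford_of_complex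
        vecy_def sum gen_def)
qed

lemma scaleR_wave_coeff: "r *\<^sub>R wave_coeff s c d = wave_coeff s (of_real r * c) (of_real r * d)"
  by (rule clifford_eqI)
    (simp add: wave_coeff_def coeff_mult_clifford_of_complex coeff_clifford_of_complex
      scaleR_conv_of_real [where 'a = complex] algebra_simps)

lemma vecy_wave_coeff:
  assumes "norm s = 1"
  shows "vecy s * wave_coeff s c d = wave_coeff s (- d) c"
proof -
  have "vecy s * (vecy s * clifford_of_complex d) = clifford_of_complex (- d)"
    unfolding mult.assoc [symmetric] vecy_square using assms
    by (auto intro: clifford_eqI simp: coeff_clifford_of_complex)
  then show ?thesis
    by (simp add: wave_coeff_def distrib_left add.commute)
qed

lemma wave_coeff_eq_iff:
  assumes "norm s = 1"
  shows "wave_coeff s c d = wave_coeff s c' d' \<longleftrightarrow> c = c' \<and> d = d'"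
  using coeff_wave_coeff_empty vecy_wave_coeff [OF assms] neg_equal_iff_equal by metis

lemma norm_wave_coeff_ge:
  fixes s :: "real ^ 'q::{finite,linorder}"
  assumes "norm s = 1"
  shows "norm c \<le> norm (wave_coeff s c d :: ('p::{finite,linorder} + 'q) clifford)"
    and "norm d \<le> norm (vecy s :: ('p + 'q) clifford) * norm (wave_coeff s c d :: ('p + 'q) clifford)"
proof -
  show c: "norm c \<le> norm (wave_coeff s c d :: ('p + 'q) clifford)" for c d
    using norm_coeff_le [of "wave_coeff s c d" "{}"] by (simp add: coeff_wave_coeff_empty)
  have "norm d \<le> norm (vecy s * wave_coeff s c d :: ('p + 'q) clifford)"
    unfolding vecy_wave_coeff [OF assms] using c [of "- d" c] by simp
  also have "\<dots> \<le> norm (vecy s :: ('p + 'q) clifford) * norm (wave_coeff s c d :: ('p + 'q) clifford)"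
    by (rule norm_mult_ineq)
  finally show "norm d \<le> norm (vecy s :: ('p + 'q) clifford) * norm (wave_coeff s c d :: ('p + 'q) clifford)" .
qed

lemma norm_wave_coeff_le:
  fixes s :: "real ^ 'q::{finite,linorder}"
  shows "norm (wave_coeff s c d :: ('p + 'q) clifford) \<le>
    norm c + norm (vecy s :: ('p::{finite,linorder} + 'q) clifford) * norm d"
proof -
  have "norm (wave_coeff s c d :: ('p + 'q) clifford) \<le>
      norm (clifford_of_complex c :: ('p + 'q) clifford) +
      norm (vecy s * clifford_of_complex d :: ('p + 'q) clifford)"
    unfolding wave_coeff_def by (rule norm_triangle_ineq)
  also have "\<dots> \<le> norm (clifford_of_complex c :: ('p + 'q) clifford) +
      norm (vecy s :: ('p + 'q) clifford) * norm (clifford_of_complex d :: ('p + 'q) clifford)"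
    by (intro add_left_mono norm_mult_ineq)
  finally show ?thesis by (simp only: norm_clifford_of_complex)
qed

lemma has_vector_derivative_wave_coeff:
  assumes "(f has_vector_derivative f') (at t)" "(g has_vector_derivative g') (at t)"
  shows "((\<lambda>t. wave_coeff s (f t) (g t)) has_vector_derivative wave_coeff s f' g') (at t)"
  unfolding wave_coeff_def
  by (intro has_vector_derivative_add has_vector_derivative_mult_right
      bounded_linear.has_vector_derivative [OF bounded_linear_clifford_of_complex] assms)

lemma continuous_on_wave_coeff:
  assumes "continuous_on S f" "continuous_on S g"
  shows "continuous_on S (\<lambda>t. wave_coeff s (f t) (g t))"
  unfolding wave_coeff_def
  by (intro continuous_intros bounded_linear.continuous_on [OF bounded_linear_clifford_of_complex] assms)

lemma abs_real_beta_le: "\<bar>real_beta p j\<bar> \<le> real (j + p)"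
  by (cases j) (auto simp: real_beta_def)

lemma abs_real_beta_ge:
  assumes "0 < j" "0 < p"
  shows "real j \<le> \<bar>real_beta p j\<bar>"
proof -
  have "1 \<le> real j" "1 \<le> real p" using assms by simp_all
  then show ?thesis by (auto simp: real_beta_def)
qed

text \<open>
  These are the coefficients \<open>z\<^sub>j\<close> for which \<open>s \<Sum> x\<^sup>j z\<^sub>j = - \<partial>\<^sub>x \<Sum> x\<^sup>j w\<^sub>j\<close>; the sign \<open>(-1)\<^sup>j\<close> comes from
  moving \<open>s\<close> past \<open>x\<^sup>j\<close>.
\<close>
definition shifted_coeff :: "real ^ 'q::{finite,linorder} \<Rightarrow> (nat \<Rightarrow> ('p::{finite,linorder} + 'q) clifford) \<Rightarrow> nat \<Rightarrow> ('p + 'q) clifford" where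
  "shifted_coeff s W j = ((- 1) ^ j * real_beta CARD('p) (Suc j)) *\<^sub>R (vecy s * W (Suc j))"

lemma shifted_coeff_bound:
  fixes x :: "real ^ 'p::{finite,linorder}" and s :: "real ^ 'q::{finite,linorder}"
    and W :: "nat \<Rightarrow> ('p + 'q) clifford"
  assumes K: "\<And>j. norm (W j) * R ^ j \<le> K" and x: "norm x < R"
  defines "M \<equiv> \<lambda>j. real CARD('p) * norm (vecy s :: ('p + 'q) clifford) * K / R *
    (real (j + Suc CARD('p)) * (norm x / R) ^ j)"
  shows "norm (vecx x ^ j * shifted_coeff s W j) \<le> M j" and "summable M"
proof -
  let ?s = "vecy s :: ('p + 'q) clifford"
  have R: "0 < R" using x norm_ge_zero [of x] by linarith
  have "norm (W (Suc j)) \<le> K / R ^ Suc j"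
    using K [of "Suc j"] R by (simp add: pos_le_divide_eq)
  then have "norm ?s * norm (W (Suc j)) \<le> norm ?s * (K / R ^ Suc j)"
    by (rule mult_left_mono) auto
  then have sW: "norm (?s * W (Suc j)) \<le> norm ?s * (K / R ^ Suc j)"
    using norm_mult_ineq order_trans by blast
  have Z: "norm (shifted_coeff s W j) \<le> real (Suc j + CARD('p)) * (norm ?s * (K / R ^ Suc j))"
    unfolding shifted_coeff_def norm_scaleR abs_mult power_abs
    using abs_real_beta_le [of "CARD('p)" "Suc j"] by (intro mult_mono sW) auto
  have "norm (vecx x ^ j * shifted_coeff s W j) \<le>
      norm (vecx x ^ j :: ('p + 'q) clifford) * norm (shifted_coeff s W j)"
    by (rule norm_mult_ineq)
  also have "\<dots> \<le> (real CARD('p) * norm x ^ j) * (real (Suc j + CARD('p)) * (norm ?s * (K / R ^ Suc j)))"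
    by (intro mult_mono Z norm_vecx_power_le) auto
  also have "\<dots> = M j"
    by (simp add: M_def power_divide)
  finally show "norm (vecx x ^ j * shifted_coeff s W j) \<le> M j" .
  show "summable M"
    unfolding M_def using x R by (intro summable_mult summable_linear_times_geometric) auto
qed

lemma vecy_mult_shifted_coeff:
  fixes x :: "real ^ 'p::{finite,linorder}" and s :: "real ^ 'q::{finite,linorder}"
    and W :: "nat \<Rightarrow> ('p + 'q) clifford"
  assumes "norm s = 1"
  shows "vecy s * (vecx x ^ j * shifted_coeff s W j) =
    - (real_beta CARD('p) (Suc j) *\<^sub>R (vecx x ^ j * W (Suc j)))"
proof -
  have "vecy s * (vecx x ^ j * shifted_coeff s W j) =
      (vecy s * vecx x ^ j) * shifted_coeff s W j"
    by (simp only: mult.assoc)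
  also have "\<dots> = real_beta CARD('p) (Suc j) *\<^sub>R (vecx x ^ j * ((vecy s * vecy s) * W (Suc j)))"
    unfolding vecy_vecx_power shifted_coeff_def
    by (cases "even j") (simp_all add: mult.assoc)
  also have "\<dots> = - (real_beta CARD('p) (Suc j) *\<^sub>R (vecx x ^ j * W (Suc j)))"
    unfolding vecy_square using assms by simp
  finally show ?thesis .
qed

section \<open>Hypermonogenic plane waves\<close>
locale plane_wave =
  fixes s :: "real ^ 'q::{finite,linorder}"
    and \<Omega> :: "((real ^ 'p::{finite,linorder}) \<times> (real ^ 'q::_)) set"
    and U :: "complex set"
    and C D :: "nat \<Rightarrow> complex \<Rightarrow> complex"
    and F :: "(real ^ 'p::_) \<times> (real ^ 'q::_) \<Rightarrow> ('p + 'q) clifford"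
  assumes s: "norm s = 1"
    and \<Omega>: "open \<Omega>"
    and U: "open U" "\<And>x y. (x, y) \<in> \<Omega> \<Longrightarrow> of_real (y \<bullet> s) \<in> U"
    and CD: "\<And>j. C j holomorphic_on U" "\<And>j. D j holomorphic_on U"
    and F: "plane_wave_on \<Omega> s C D F"
begin

text \<open>
  The recurrence concerns the amplitudes only on this set of values of \<open>\<langle>y, s\<rangle>\<close>.
\<close>
definition phases :: "real set" where
  "phases = (\<lambda>(x, y). y \<bullet> s) ` \<Omega>"

definition amp :: "nat \<Rightarrow> real \<Rightarrow> ('p + 'q) clifford" where
  "amp j t = wave_coeff s (C j (of_real t)) (D j (of_real t))"

definition amp' :: "nat \<Rightarrow> real \<Rightarrow> ('p + 'q) clifford" where
  "amp' j t = wave_coeff s (deriv (C j) (of_real t)) (deriv (D j) (of_real t))"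

definition rec_rhs :: "nat \<Rightarrow> real \<Rightarrow> ('p + 'q) clifford" where
  "rec_rhs j t = shifted_coeff s (\<lambda>j. amp j t) j"

lemma s_inner: "s \<bullet> s = 1"
  using s by (simp add: norm_eq_1)

lemma phases_I: "(x, y) \<in> \<Omega> \<Longrightarrow> y \<bullet> s \<in> phases"
  by (force simp: phases_def)

lemma phases_in_U: "t \<in> phases \<Longrightarrow> of_real t \<in> U"
  using U(2) by (auto simp: phases_def)

lemma F_sums: "(x, y) \<in> \<Omega> \<Longrightarrow> (\<lambda>j. vecx x ^ j * amp j (y \<bullet> s)) sums F (x, y)"
  using F unfolding plane_wave_on_def amp_def wave_coeff_def by blast

lemma product_neighbourhood:
  assumes "(x, y) \<in> \<Omega>"
  obtains \<epsilon> where "0 < \<epsilon>" "\<And>x' y'. dist x' x < \<epsilon> \<Longrightarrow> dist y' y < \<epsilon> \<Longrightarrow> (x', y') \<in> \<Omega>"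
proof -
  obtain A B where AB: "open A" "open B" "x \<in> A" "y \<in> B" "A \<times> B \<subseteq> \<Omega>"
    using open_prod_elim [OF \<Omega> assms] by (metis mem_Sigma_iff)
  obtain e1 e2 where "e1 > 0" "ball x e1 \<subseteq> A" "e2 > 0" "ball y e2 \<subseteq> B"
    using AB open_contains_ball by metis
  then show ?thesis
    using AB(5) by (intro that [of "min e1 e2"]) (auto simp: subset_iff dist_commute)
qed

text \<open>
  Moving along \<open>\<omega>\<close> and along \<open>s\<close> varies the radius and the value of \<open>\<langle>y, s\<rangle>\<close> independently. The
  radius can always be increased, also from \<open>x = 0\<close>, where \<open>\<omega>\<close> is an arbitrary unit vector.
\<close>
lemma radial_box:
  assumes "(x, y) \<in> \<Omega>"
  obtains \<omega> \<delta> where "norm \<omega> = 1" "x = norm x *\<^sub>R \<omega>" "0 < \<delta>"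
    "\<And>r t. \<bar>r - norm x\<bar> \<le> \<delta> \<Longrightarrow> \<bar>t - y \<bullet> s\<bar> \<le> \<delta> \<Longrightarrow>
      (r *\<^sub>R \<omega>, y + (t - y \<bullet> s) *\<^sub>R s) \<in> \<Omega>"
proof -
  obtain \<epsilon> where \<epsilon>: "0 < \<epsilon>" "\<And>x' y'. dist x' x < \<epsilon> \<Longrightarrow> dist y' y < \<epsilon> \<Longrightarrow> (x', y') \<in> \<Omega>"
    using product_neighbourhood [OF assms] by blast
  obtain \<omega> where \<omega>: "norm \<omega> = 1" "x = norm x *\<^sub>R \<omega>"
  proof (cases "x = 0")
    case True
    then show ?thesis using that [of "axis undefined 1"] by (simp add: norm_axis_1)
  next
    case False
    then show ?thesis using that [of "x /\<^sub>R norm x"] by simp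
  qed
  show ?thesis
  proof (rule that [OF \<omega>, of "\<epsilon> / 2"])
    fix r t :: real
    assume r: "\<bar>r - norm x\<bar> \<le> \<epsilon> / 2" and t: "\<bar>t - y \<bullet> s\<bar> \<le> \<epsilon> / 2"
    have "r *\<^sub>R \<omega> - x = (r - norm x) *\<^sub>R \<omega>"
      using \<omega>(2) by (metis scaleR_diff_left)
    then show "(r *\<^sub>R \<omega>, y + (t - y \<bullet> s) *\<^sub>R s) \<in> \<Omega>"
      using r t \<epsilon>(1) \<omega>(1) s by (intro \<epsilon>(2)) (auto simp: dist_norm)
  qed (use \<epsilon> in auto)
qed

lemma inner_shift: "(y + (t - y \<bullet> s) *\<^sub>R s) \<bullet> s = t"
  by (simp add: inner_add_left s_inner)

lemma open_phases: "open phases"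
  unfolding open_dist
proof
  fix t assume "t \<in> phases"
  then obtain x y where xy: "(x, y) \<in> \<Omega>" "t = y \<bullet> s" by (auto simp: phases_def)
  obtain \<omega> \<delta> where \<delta>: "0 < \<delta>"
    "\<And>r t. \<bar>r - norm x\<bar> \<le> \<delta> \<Longrightarrow> \<bar>t - y \<bullet> s\<bar> \<le> \<delta> \<Longrightarrow> (r *\<^sub>R \<omega>, y + (t - y \<bullet> s) *\<^sub>R s) \<in> \<Omega>"
    using radial_box [OF xy(1)] by metis
  have "t' \<in> phases" if "dist t' t < \<delta>" for t'
    using phases_I [OF \<delta>(2) [of "norm x" t']] that \<delta>(1) by (simp add: inner_shift dist_real_def xy(2))
  then show "\<exists>e>0. \<forall>t'. dist t' t < e \<longrightarrow> t' \<in> phases" using \<delta>(1) by blast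
qed

lemma amp_deriv: "t \<in> phases \<Longrightarrow> (amp j has_vector_derivative amp' j t) (at t)"
  unfolding amp_def [abs_def] amp'_def
  by (intro has_vector_derivative_wave_coeff has_vector_derivative_real_field
      holomorphic_derivI [OF CD(1) U(1)] holomorphic_derivI [OF CD(2) U(1)] phases_in_U)

lemma continuous_on_holomorphic_real:
  assumes "g holomorphic_on U" "S \<subseteq> phases"
  shows "continuous_on S (\<lambda>t. g (of_real t))"
  by (rule continuous_on_compose2 [OF holomorphic_on_imp_continuous_on [OF assms(1)]])
    (use assms(2) phases_in_U in \<open>auto intro!: continuous_intros\<close>)

lemma continuous_on_amp: "S \<subseteq> phases \<Longrightarrow> continuous_on S (amp j)"
  unfolding amp_def [abs_def] by (intro continuous_on_wave_coeff continuous_on_holomorphic_real CD)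

lemma continuous_on_amp': "S \<subseteq> phases \<Longrightarrow> continuous_on S (amp' j)"
  unfolding amp'_def [abs_def]
  by (intro continuous_on_wave_coeff continuous_on_holomorphic_real holomorphic_deriv CD U(1))

lemma continuous_on_rec_rhs: "S \<subseteq> phases \<Longrightarrow> continuous_on S (rec_rhs j)"
  unfolding rec_rhs_def [abs_def] shifted_coeff_def
  by (intro continuous_intros continuous_on_amp)

lemma recurrence_iff:
  "amp' j t = rec_rhs j t \<longleftrightarrow>
    beta CARD('p) (j + 1) * C (j + 1) (of_real t) - (-1) ^ j * deriv (D j) (of_real t) = 0 \<and>
    beta CARD('p) (j + 1) * D (j + 1) (of_real t) + (-1) ^ j * deriv (C j) (of_real t) = 0"
proof -
  have "rec_rhs j t = wave_coeff s (- ((- 1) ^ j * beta CARD('p) (Suc j) * D (Suc j) (of_real t)))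
      ((- 1) ^ j * beta CARD('p) (Suc j) * C (Suc j) (of_real t))"
    unfolding rec_rhs_def shifted_coeff_def amp_def vecy_wave_coeff [OF s] scaleR_wave_coeff beta_eq_of_real
    by simp
  then have "amp' j t = rec_rhs j t \<longleftrightarrow>
      deriv (C j) (of_real t) = - ((- 1) ^ j * beta CARD('p) (Suc j) * D (Suc j) (of_real t)) \<and>
      deriv (D j) (of_real t) = (- 1) ^ j * beta CARD('p) (Suc j) * C (Suc j) (of_real t)"
    by (simp only: amp'_def wave_coeff_eq_iff [OF s])
  then show ?thesis
    by (cases "even j") (auto simp: eq_neg_iff_add_eq_0 add.commute)
qed

lemma coefficients_bounded:
  assumes "(x, y) \<in> \<Omega>" "x \<noteq> 0"
  obtains K where "\<And>j. norm (amp j (y \<bullet> s)) * norm x ^ j \<le> K"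
proof -
  have "summable (\<lambda>j. vecx x ^ j * amp j (y \<bullet> s))"
    using F_sums [OF assms(1)] by (simp add: sums_iff)
  then have "Bseq (\<lambda>j. vecx x ^ j * amp j (y \<bullet> s))"
    using summable_LIMSEQ_zero convergent_imp_Bseq convergentI by blast
  then obtain K where K: "\<And>j. norm (vecx x ^ j * amp j (y \<bullet> s)) \<le> K"
    by (auto simp: Bseq_def)
  have "norm (amp j (y \<bullet> s)) * norm x ^ j \<le> real CARD('p) * K" for j
  proof -
    have "norm x ^ j * norm (amp j (y \<bullet> s)) \<le> real CARD('p) * norm (vecx x ^ j * amp j (y \<bullet> s))"
      by (rule norm_le_norm_vecx_power_mult)
    also have "\<dots> \<le> real CARD('p) * K"
      by (intro mult_left_mono K) auto
    finally show ?thesis by (simp add: mult.commute)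
  qed
  then show ?thesis by (rule that)
qed

text \<open>
  Convergence at a point of \<open>\<Omega>\<close> slightly further out than \<open>x\<close> bounds the coefficients at a radius
  \<open>R > |x|\<close>, which is what makes all series in \<open>x\<close> converge absolutely.
\<close>
lemma coefficients_bounded_beyond:
  assumes "(x, y) \<in> \<Omega>"
  obtains R K where "norm x < R" "\<And>j. norm (amp j (y \<bullet> s)) * R ^ j \<le> K"
proof -
  obtain \<omega> \<delta> where \<omega>: "norm \<omega> = 1" and \<delta>: "0 < \<delta>"
    "\<And>r t. \<bar>r - norm x\<bar> \<le> \<delta> \<Longrightarrow> \<bar>t - y \<bullet> s\<bar> \<le> \<delta> \<Longrightarrow> (r *\<^sub>R \<omega>, y + (t - y \<bullet> s) *\<^sub>R s) \<in> \<Omega>"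
    using radial_box [OF assms] by metis
  let ?R = "norm x + \<delta>"
  have R: "norm x < ?R" "0 < ?R" using \<delta>(1) norm_ge_zero [of x] by linarith+
  have "(?R *\<^sub>R \<omega>, y) \<in> \<Omega>" using \<delta>(2) [of ?R "y \<bullet> s"] \<delta>(1) by simp
  moreover have "?R *\<^sub>R \<omega> \<noteq> 0" using R \<omega> by auto
  ultimately obtain K where "\<And>j. norm (amp j (y \<bullet> s)) * norm (?R *\<^sub>R \<omega>) ^ j \<le> K"
    using coefficients_bounded by blast
  then show ?thesis using R \<omega> by (intro that [of ?R K]) auto
qed

lemma dirac_x_F:
  assumes xy: "(x, y) \<in> \<Omega>"
  shows "(\<lambda>h. F (x + h *\<^sub>R axis i 1, y)) differentiable (at 0)"
    and "vecy s * (\<Sum>j. vecx x ^ j * rec_rhs j (y \<bullet> s)) = - dirac_x F x y"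
    and "summable (\<lambda>j. vecx x ^ j * rec_rhs j (y \<bullet> s))"
proof -
  obtain R K where R: "norm x < R" and K: "\<And>j. norm (amp j (y \<bullet> s)) * R ^ j \<le> K"
    using coefficients_bounded_beyond [OF xy] by blast
  obtain \<epsilon> where \<epsilon>: "0 < \<epsilon>" "\<And>x' y'. dist x' x < \<epsilon> \<Longrightarrow> dist y' y < \<epsilon> \<Longrightarrow> (x', y') \<in> \<Omega>"
    using product_neighbourhood [OF xy] by blast
  have F': "(\<lambda>j. vecx x' ^ j * amp j (y \<bullet> s)) sums F (x', y)" if "dist x' x < \<epsilon>" for x'
    using \<epsilon> that by (intro F_sums) auto
  show "(\<lambda>h. F (x + h *\<^sub>R axis i 1, y)) differentiable (at 0)"
    by (rule dirac_x_power_series(1) [OF K R \<epsilon>(1) F'])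
  show sm: "summable (\<lambda>j. vecx x ^ j * rec_rhs j (y \<bullet> s))"
    unfolding rec_rhs_def
    by (rule summable_comparison_test' [OF shifted_coeff_bound(2) [OF K R], of 0])
      (rule shifted_coeff_bound(1) [OF K R])
  have "vecy s * (\<Sum>j. vecx x ^ j * rec_rhs j (y \<bullet> s)) = (\<Sum>j. vecy s * (vecx x ^ j * rec_rhs j (y \<bullet> s)))"
    by (rule suminf_mult [OF sm, symmetric])
  also have "\<dots> = (\<Sum>j. - (real_beta CARD('p) (Suc j) *\<^sub>R (vecx x ^ j * amp (Suc j) (y \<bullet> s))))"
    unfolding rec_rhs_def by (simp only: vecy_mult_shifted_coeff [OF s])
  also have "\<dots> = - (\<Sum>j. real_beta CARD('p) (Suc j) *\<^sub>R (vecx x ^ j * amp (Suc j) (y \<bullet> s)))"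
  proof (rule suminf_minus)
    have "summable (\<lambda>j. vecy s * (vecx x ^ j * rec_rhs j (y \<bullet> s)))"
      by (rule summable_mult [OF sm])
    then have "summable (\<lambda>j. - (real_beta CARD('p) (Suc j) *\<^sub>R (vecx x ^ j * amp (Suc j) (y \<bullet> s))))"
      unfolding rec_rhs_def by (simp only: vecy_mult_shifted_coeff [OF s])
    then show "summable (\<lambda>j. real_beta CARD('p) (Suc j) *\<^sub>R (vecx x ^ j * amp (Suc j) (y \<bullet> s)))"
      by (simp only: summable_minus_iff)
  qed
  also have "\<dots> = - dirac_x F x y"
    using dirac_x_power_series(2) [OF K R \<epsilon>(1) F'] by simp
  finally show "vecy s * (\<Sum>j. vecx x ^ j * rec_rhs j (y \<bullet> s)) = - dirac_x F x y" .
qed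

lemma F_profile:
  assumes "(x, y) \<in> \<Omega>"
  obtains \<epsilon> where "0 < \<epsilon>"
    "\<And>y'. dist y' y < \<epsilon> \<Longrightarrow> F (x, y') = (\<lambda>t. \<Sum>j. vecx x ^ j * amp j t) (y' \<bullet> s)"
proof -
  obtain \<epsilon> where \<epsilon>: "0 < \<epsilon>" "\<And>x' y'. dist x' x < \<epsilon> \<Longrightarrow> dist y' y < \<epsilon> \<Longrightarrow> (x', y') \<in> \<Omega>"
    using product_neighbourhood [OF assms] by blast
  show ?thesis
  proof (rule that [OF \<epsilon>(1)])
    fix y' assume "dist y' y < \<epsilon>"
    then have "(x, y') \<in> \<Omega>" using \<epsilon> by auto
    then show "F (x, y') = (\<lambda>t. \<Sum>j. vecx x ^ j * amp j t) (y' \<bullet> s)"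
      using F_sums by (simp add: sums_iff)
  qed
qed

text \<open>
  The two Dirac operators are evaluated by the lemmas above; \<open>s\<close> can be cancelled on the left because
  \<open>s\<^sup>2 = -1\<close>.
\<close>
lemma hypermonogenic_iff_profile_derivative:
  "hypermonogenic_on \<Omega> F \<longleftrightarrow> (\<forall>(x, y)\<in>\<Omega>.
    ((\<lambda>t. \<Sum>j. vecx x ^ j * amp j t) has_vector_derivative
      (\<Sum>j. vecx x ^ j * rec_rhs j (y \<bullet> s))) (at (y \<bullet> s)))" (is "_ \<longleftrightarrow> (\<forall>(x, y)\<in>\<Omega>. ?P x y)")
proof
  assume hyp: "hypermonogenic_on \<Omega> F"
  show "\<forall>(x, y)\<in>\<Omega>. ?P x y"
  proof clarify
    fix x y assume xy: "(x, y) \<in> \<Omega>"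
    obtain \<epsilon> where \<epsilon>: "0 < \<epsilon>"
      "\<And>y'. dist y' y < \<epsilon> \<Longrightarrow> F (x, y') = (\<lambda>t. \<Sum>j. vecx x ^ j * amp j t) (y' \<bullet> s)"
      using F_profile [OF xy] by blast
    have "s \<noteq> 0" using s by auto
    moreover have "(\<lambda>h. F (x, y + h *\<^sub>R axis i 1)) differentiable (at (0::real))" for i
      using hyp xy unfolding hypermonogenic_on_def by blast
    ultimately obtain f' where
      f': "((\<lambda>t. \<Sum>j. vecx x ^ j * amp j t) has_vector_derivative f') (at (y \<bullet> s))"
      using plane_wave_profile_differentiable [where F = F and x = x and y = y, OF _ _ \<epsilon>] by blast
    have "dirac_x F x y + vecy s * f' = 0"
      using hyp xy dirac_y_plane_wave [where F = F and x = x and y = y, OF f' \<epsilon>]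
      unfolding hypermonogenic_on_def by auto
    then have "vecy s * f' = vecy s * (\<Sum>j. vecx x ^ j * rec_rhs j (y \<bullet> s))"
      unfolding dirac_x_F(2) [OF xy] by (simp add: add_eq_0_iff)
    then have "vecy s * vecy s * f' = vecy s * vecy s * (\<Sum>j. vecx x ^ j * rec_rhs j (y \<bullet> s))"
      by (simp only: mult.assoc)
    then show "?P x y"
      using f' by (simp add: vecy_square s)
  qed
next
  assume P: "\<forall>(x, y)\<in>\<Omega>. ?P x y"
  show "hypermonogenic_on \<Omega> F"
    unfolding hypermonogenic_on_def
  proof clarify
    fix x y assume xy: "(x, y) \<in> \<Omega>"
    obtain \<epsilon> where \<epsilon>: "0 < \<epsilon>"
      "\<And>y'. dist y' y < \<epsilon> \<Longrightarrow> F (x, y') = (\<lambda>t. \<Sum>j. vecx x ^ j * amp j t) (y' \<bullet> s)"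
      using F_profile [OF xy] by blast
    have f': "?P x y" using P xy by blast
    have "dirac_x F x y + dirac_y F x y = 0"
      using dirac_y_plane_wave [where F = F and x = x and y = y, OF f' \<epsilon>] dirac_x_F(2) [OF xy] by simp
    moreover have "(\<lambda>h. F (x, y + h *\<^sub>R axis i 1)) differentiable (at (0::real))" for i
      by (rule differentiableI_vector) (rule has_vector_derivative_plane_wave [where F = F, OF f' \<epsilon>])
    ultimately show "(\<forall>j. (\<lambda>h. F (x + h *\<^sub>R axis j 1, y)) differentiable (at 0)) \<and>
        (\<forall>j. (\<lambda>h. F (x, y + h *\<^sub>R axis j 1)) differentiable (at 0)) \<and>
        dirac_x F x y + dirac_y F x y = 0"
      using dirac_x_F(1) [OF xy] by blast
  qed
qed

text \<open>
  Alternating between the two families untangles the recurrence: both \<open>C\<^sub>0, D\<^sub>1, C\<^sub>2, \<dots>\<close> and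
  \<open>D\<^sub>0, C\<^sub>1, D\<^sub>2, \<dots>\<close> are chains in which each function is a multiple of the derivative of the previous one.
\<close>
lemma recurrence_imp_coefficients_locally_bounded:
  assumes rec: "\<And>j t. t \<in> phases \<Longrightarrow> amp' j t = rec_rhs j t"
    and t0: "t0 \<in> phases" and K: "\<And>j. norm (amp j t0) * R ^ j \<le> K" and \<rho>: "0 < \<rho>" "\<rho> < R"
  obtains \<eta> B where "0 < \<eta>" "\<And>t. \<bar>t - t0\<bar> < \<eta> \<Longrightarrow> t \<in> phases"
    "\<And>t j. \<bar>t - t0\<bar> < \<eta> \<Longrightarrow> norm (amp j t) * \<rho> ^ j \<le> B"
proof -
  let ?s = "norm (vecy s :: ('p + 'q) clifford)"
  define P where "P j = (if even j then C j else D j)" for j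
  define Q where "Q j = (if even j then D j else C j)" for j
  have hol: "P j holomorphic_on U" "Q j holomorphic_on U" for j
    using CD by (auto simp: P_def Q_def)
  have step: "deriv (P j) (of_real t) = - beta CARD('p) (Suc j) * P (Suc j) (of_real t)"
    "deriv (Q j) (of_real t) = beta CARD('p) (Suc j) * Q (Suc j) (of_real t)" if "t \<in> phases" for j t
    using rec [OF that, of j, unfolded recurrence_iff]
    by (cases "even j"; simp add: P_def Q_def add_eq_0_iff)+
  have b: "real j \<le> norm (beta CARD('p) j)" if "0 < j" for j
    using abs_real_beta_ge [OF that, of "CARD('p)"] by (simp add: beta_eq_of_real)
  have b': "norm (beta CARD('p) j) \<le> real (j + CARD('p))" for j
    using abs_real_beta_le [of "CARD('p)" j] by (simp add: beta_eq_of_real)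
  have R: "0 < R" using \<rho> by linarith
  have C_le: "norm (C j (of_real t0)) * R ^ j \<le> K" for j
  proof -
    have "norm (C j (of_real t0)) * R ^ j \<le> norm (amp j t0) * R ^ j"
      unfolding amp_def using R by (intro mult_right_mono norm_wave_coeff_ge(1) s) auto
    then show ?thesis using K [of j] by linarith
  qed
  have D_le: "norm (D j (of_real t0)) * R ^ j \<le> ?s * K" for j
  proof -
    have "norm (D j (of_real t0)) * R ^ j \<le> ?s * norm (amp j t0) * R ^ j"
      unfolding amp_def using R by (intro mult_right_mono norm_wave_coeff_ge(2) s) auto
    also have "\<dots> \<le> ?s * K"
      using mult_left_mono [OF K [of j], of ?s] by (simp add: mult.assoc)
    finally show ?thesis .
  qed
  have PQ_le: "norm (P j (of_real t0)) * R ^ j \<le> max K (?s * K)"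
    "norm (Q j (of_real t0)) * R ^ j \<le> max K (?s * K)" for j
    using C_le [of j] D_le [of j] by (auto simp: P_def Q_def le_max_iff_disj)
  obtain \<eta>1 B1 where \<eta>1: "0 < \<eta>1" "\<And>t. \<bar>t - t0\<bar> < \<eta>1 \<Longrightarrow> t \<in> phases"
    "\<And>t j. \<bar>t - t0\<bar> < \<eta>1 \<Longrightarrow> norm (P j (of_real t)) * \<rho> ^ j \<le> B1"
    by (rule derivative_chain_locally_bounded [of U P phases t0 "\<lambda>j. - beta CARD('p) j" "CARD('p)" R _ \<rho>,
          OF U(1) hol(1) open_phases phases_in_U t0 step(1) _ _ PQ_le(1) \<rho>])
      (use b b' in auto)
  obtain \<eta>2 B2 where \<eta>2: "0 < \<eta>2"
    "\<And>t j. \<bar>t - t0\<bar> < \<eta>2 \<Longrightarrow> norm (Q j (of_real t)) * \<rho> ^ j \<le> B2"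
    by (rule derivative_chain_locally_bounded [of U Q phases t0 "beta CARD('p)" "CARD('p)" R _ \<rho>,
          OF U(1) hol(2) open_phases phases_in_U t0 step(2) _ _ PQ_le(2) \<rho>])
      (use b b' in auto)
  show ?thesis
  proof (rule that)
    show "0 < min \<eta>1 \<eta>2" using \<eta>1 \<eta>2 by simp
    show "t \<in> phases" if "\<bar>t - t0\<bar> < min \<eta>1 \<eta>2" for t
      using that \<eta>1 by simp
    show "norm (amp j t) * \<rho> ^ j \<le> max B1 B2 + ?s * max B1 B2" if "\<bar>t - t0\<bar> < min \<eta>1 \<eta>2" for t j
    proof -
      have "norm (C j (of_real t)) * \<rho> ^ j \<le> max B1 B2" "norm (D j (of_real t)) * \<rho> ^ j \<le> max B1 B2"
        using \<eta>1(3) [of t j] \<eta>2(2) [of t j] that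
        by (auto simp: P_def Q_def le_max_iff_disj split: if_splits)
      then have "norm (C j (of_real t)) * \<rho> ^ j + ?s * (norm (D j (of_real t)) * \<rho> ^ j) \<le>
          max B1 B2 + ?s * max B1 B2"
        by (intro add_mono mult_left_mono) auto
      moreover have "norm (amp j t) * \<rho> ^ j \<le>
          (norm (C j (of_real t)) + ?s * norm (D j (of_real t))) * \<rho> ^ j"
        unfolding amp_def using \<rho> by (intro mult_right_mono norm_wave_coeff_le) auto
      ultimately show ?thesis
        by (simp add: algebra_simps)
    qed
  qed
qed

lemma recurrence_imp_profile_derivative:
  assumes rec: "\<And>j t. t \<in> phases \<Longrightarrow> amp' j t = rec_rhs j t" and xy: "(x, y) \<in> \<Omega>"
  shows "((\<lambda>t. \<Sum>j. vecx x ^ j * amp j t) has_vector_derivative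
      (\<Sum>j. vecx x ^ j * rec_rhs j (y \<bullet> s))) (at (y \<bullet> s))"
proof -
  obtain R K where R: "norm x < R" and K: "\<And>j. norm (amp j (y \<bullet> s)) * R ^ j \<le> K"
    using coefficients_bounded_beyond [OF xy] by blast
  obtain \<rho> where \<rho>: "norm x < \<rho>" "\<rho> < R" using dense R by blast
  have "0 < \<rho>" using \<rho> norm_ge_zero [of x] by linarith
  obtain \<eta> B where \<eta>: "0 < \<eta>" "\<And>t. \<bar>t - y \<bullet> s\<bar> < \<eta> \<Longrightarrow> t \<in> phases"
    and B: "\<And>t j. \<bar>t - y \<bullet> s\<bar> < \<eta> \<Longrightarrow> norm (amp j t) * \<rho> ^ j \<le> B"
    using recurrence_imp_coefficients_locally_bounded [OF rec phases_I [OF xy] K \<open>0 < \<rho>\<close> \<rho>(2)] by blast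
  show ?thesis
  proof (rule termwise_vector_derivative [OF \<eta>(1)])
    fix j t assume t: "\<bar>t - y \<bullet> s\<bar> < \<eta>"
    show "((\<lambda>t. vecx x ^ j * amp j t) has_vector_derivative vecx x ^ j * rec_rhs j t) (at t)"
      using amp_deriv [OF \<eta>(2) [OF t]] rec [OF \<eta>(2) [OF t]]
      by (intro has_vector_derivative_mult_right) simp
    show "norm (vecx x ^ j * rec_rhs j t) \<le> real CARD('p) * norm (vecy s :: ('p + 'q) clifford) * B / \<rho> *
        (real (j + Suc CARD('p)) * (norm x / \<rho>) ^ j)"
      unfolding rec_rhs_def by (rule shifted_coeff_bound(1) [OF B [OF t] \<rho>(1)])
  next
    show "summable (\<lambda>j. real CARD('p) * norm (vecy s :: ('p + 'q) clifford) * B / \<rho> *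
        (real (j + Suc CARD('p)) * (norm x / \<rho>) ^ j))"
      by (rule shifted_coeff_bound(2) [where W = "\<lambda>j. amp j (y \<bullet> s)", OF B \<rho>(1)]) (use \<eta>(1) in simp)
    show "summable (\<lambda>j. vecx x ^ j * amp j (y \<bullet> s))"
      using F_sums [OF xy] by (simp add: sums_iff)
  qed
qed

text \<open>
  Along the ray spanned by a unit vector \<open>\<omega>\<close> the series becomes an ordinary power series in the radius
  with coefficients \<open>\<omega>\<^sup>j w\<^sub>j(t)\<close>. Its components are complex, so coefficients can be compared there, and
  \<open>\<omega>\<^sup>j\<close> is invertible.
\<close>
lemma profile_derivative_imp_recurrence:
  assumes deriv: "\<And>x y. (x, y) \<in> \<Omega> \<Longrightarrow> ((\<lambda>t. \<Sum>j. vecx x ^ j * amp j t) has_vector_derivative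
      (\<Sum>j. vecx x ^ j * rec_rhs j (y \<bullet> s))) (at (y \<bullet> s))"
    and "t0 \<in> phases"
  shows "amp' j t0 = rec_rhs j t0"
proof -
  obtain x y where xy: "(x, y) \<in> \<Omega>" and t0: "t0 = y \<bullet> s" using \<open>t0 \<in> phases\<close> by (auto simp: phases_def)
  obtain \<omega> \<delta> where \<omega>: "norm \<omega> = 1" and \<delta>: "0 < \<delta>"
    and box: "\<And>r t. \<bar>r - norm x\<bar> \<le> \<delta> \<Longrightarrow> \<bar>t - t0\<bar> \<le> \<delta> \<Longrightarrow> (r *\<^sub>R \<omega>, y + (t - t0) *\<^sub>R s) \<in> \<Omega>"
    using radial_box [OF xy] unfolding t0 by metis
  have inner: "(y + (t - t0) *\<^sub>R s) \<bullet> s = t" for t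
    unfolding t0 by (rule inner_shift)
  let ?w = "vecx \<omega> :: ('p + 'q) clifford" and ?I = "{t0 - \<delta>..t0 + \<delta>}"
  let ?r1 = "norm x + \<delta> / 2"
  have I_phases: "?I \<subseteq> phases"
  proof
    fix t assume "t \<in> ?I"
    then have "(norm x *\<^sub>R \<omega>, y + (t - t0) *\<^sub>R s) \<in> \<Omega>" using \<delta> by (intro box) auto
    then show "t \<in> phases" using phases_I inner by metis
  qed
  have power: "vecx (r *\<^sub>R \<omega>) ^ j * a = r ^ j *\<^sub>R (?w ^ j * a)" for r j and a :: "('p + 'q) clifford"
    by (simp add: vecx_scaleR scaleR_power)
  have coeff_power: "coeff (vecx (r *\<^sub>R \<omega>) ^ j * a) A = coeff (?w ^ j * a) A * of_real r ^ j"
    for r j A and a :: "('p + 'q) clifford"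
    unfolding power by (simp add: scaleR_conv_of_real [where 'a = complex] mult.commute)
  note coeff_suminf = bounded_linear.suminf [OF bounded_linear_coeff]
  note coeff_sums = bounded_linear.sums [OF bounded_linear_coeff]
  have "coeff (?w ^ j * amp' j t0) A = coeff (?w ^ j * rec_rhs j t0) A" for A
  proof (rule power_series_coeff_derivative [where ?r0.0 = "norm x" and ?r1.0 = ?r1
        and a = "t0 - \<delta>" and b = "t0 + \<delta>"
        and V = "\<lambda>j t. coeff (?w ^ j * amp j t) A" and f = "\<lambda>r t. coeff (\<Sum>j. vecx (r *\<^sub>R \<omega>) ^ j * amp j t) A"
        and V' = "\<lambda>j t. coeff (?w ^ j * amp' j t) A" and Z = "\<lambda>j t. coeff (?w ^ j * rec_rhs j t) A"])
    fix j t assume "t \<in> ?I"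
    then have t: "t \<in> phases" using I_phases by blast
    show "((\<lambda>t. coeff (?w ^ j * amp j t) A) has_vector_derivative coeff (?w ^ j * amp' j t) A) (at t)"
      by (intro bounded_linear.has_vector_derivative [OF bounded_linear_coeff]
          has_vector_derivative_mult_right amp_deriv t)
  next
    show "continuous_on ?I (\<lambda>t. coeff (?w ^ j * amp' j t) A)" for j
      by (intro bounded_linear.continuous_on [OF bounded_linear_coeff] continuous_intros
          continuous_on_amp' I_phases)
    show "continuous_on ?I (\<lambda>t. coeff (?w ^ j * rec_rhs j t) A)" for j
      by (intro bounded_linear.continuous_on [OF bounded_linear_coeff] continuous_intros
          continuous_on_rec_rhs I_phases)
  next
    fix r t assume r: "norm x < r" "r < ?r1" and t: "t \<in> ?I"
    have \<Omega>: "(r *\<^sub>R \<omega>, y + (t - t0) *\<^sub>R s) \<in> \<Omega>"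
      using r t by (intro box) (auto simp: abs_le_iff)
    have "(\<lambda>j. vecx (r *\<^sub>R \<omega>) ^ j * amp j t) sums (\<Sum>j. vecx (r *\<^sub>R \<omega>) ^ j * amp j t)"
      using F_sums [OF \<Omega>] unfolding inner by (simp add: sums_iff)
    then show "(\<lambda>j. coeff (?w ^ j * amp j t) A * of_real r ^ j) sums
        coeff (\<Sum>j. vecx (r *\<^sub>R \<omega>) ^ j * amp j t) A"
      unfolding coeff_power [symmetric] by (rule coeff_sums)
    have "summable (\<lambda>j. vecx (r *\<^sub>R \<omega>) ^ j * rec_rhs j t)"
      using dirac_x_F(3) [OF \<Omega>] unfolding inner .
    then have "(\<Sum>j. coeff (?w ^ j * rec_rhs j t) A * of_real r ^ j) =
        coeff (\<Sum>j. vecx (r *\<^sub>R \<omega>) ^ j * rec_rhs j t) A"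
      unfolding coeff_power [symmetric] by (rule coeff_suminf [symmetric])
    then show "((\<lambda>t. coeff (\<Sum>j. vecx (r *\<^sub>R \<omega>) ^ j * amp j t) A) has_vector_derivative
        (\<Sum>j. coeff (?w ^ j * rec_rhs j t) A * of_real r ^ j)) (at t)"
      using bounded_linear.has_vector_derivative [OF bounded_linear_coeff deriv [OF \<Omega>], of A]
      unfolding inner by simp
  next
    fix t assume t: "t \<in> ?I"
    have \<Omega>: "(?r1 *\<^sub>R \<omega>, y + (t - t0) *\<^sub>R s) \<in> \<Omega>"
      using t \<delta> by (intro box) (auto simp: abs_le_iff)
    have "summable (\<lambda>j. coeff (vecx (?r1 *\<^sub>R \<omega>) ^ j * rec_rhs j t) A)"
      using bounded_linear.summable [OF bounded_linear_coeff dirac_x_F(3) [OF \<Omega>]] unfolding inner .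
    then have "Bseq (\<lambda>j. coeff (vecx (?r1 *\<^sub>R \<omega>) ^ j * rec_rhs j t) A)"
      using summable_LIMSEQ_zero convergent_imp_Bseq convergentI by blast
    then obtain K where "\<And>j. norm (coeff (vecx (?r1 *\<^sub>R \<omega>) ^ j * rec_rhs j t) A) \<le> K"
      by (auto simp: Bseq_def)
    moreover have "norm (coeff (?w ^ j * rec_rhs j t) A) * ?r1 ^ j =
        norm (coeff (vecx (?r1 *\<^sub>R \<omega>) ^ j * rec_rhs j t) A)" for j
    proof -
      have "0 \<le> ?r1" using \<delta> by simp
      then show ?thesis
        unfolding coeff_power norm_mult norm_power norm_of_real by simp
    qed
    ultimately show "\<exists>K. \<forall>j. norm (coeff (?w ^ j * rec_rhs j t) A) * ?r1 ^ j \<le> K"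
      by metis
  qed (use \<delta> in auto)
  then have "?w ^ j * (amp' j t0 - rec_rhs j t0) = 0"
    by (intro clifford_eqI) (simp add: right_diff_distrib)
  then have "norm (amp' j t0 - rec_rhs j t0) \<le> 0"
    using norm_le_norm_vecx_power_mult [of \<omega> j "amp' j t0 - rec_rhs j t0"] \<omega> by simp
  then show ?thesis by simp
qed

lemma hypermonogenic_iff_recurrence:
  "hypermonogenic_on \<Omega> F \<longleftrightarrow> (\<forall>j. \<forall>(x, y)\<in>\<Omega>. let t = of_real (y \<bullet> s) in
    beta CARD('p) (j + 1) * C (j + 1) t - (-1) ^ j * deriv (D j) t = 0 \<and>
    beta CARD('p) (j + 1) * D (j + 1) t + (-1) ^ j * deriv (C j) t = 0)"
proof -
  have "hypermonogenic_on \<Omega> F \<longleftrightarrow> (\<forall>j. \<forall>t\<in>phases. amp' j t = rec_rhs j t)"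
    unfolding hypermonogenic_iff_profile_derivative
    using recurrence_imp_profile_derivative profile_derivative_imp_recurrence by fast
  then show ?thesis
    by (simp add: phases_def recurrence_iff Let_def split_beta)
qed

end

text \<open>
  Induction on \<open>j\<close>: two families that agree at index \<open>j\<close> on an open set of reals have the same complex
  derivatives there, and the recurrence then gives agreement at index \<open>j + 1\<close>.
\<close>
lemma plane_wave_determined:
  assumes w1: "plane_wave s \<Omega> U C D F" and w2: "plane_wave s \<Omega> U C2 D2 F2"
    and hyp: "hypermonogenic_on \<Omega> F" "hypermonogenic_on \<Omega> F2"
    and init: "\<forall>(x, y)\<in>\<Omega>. let t = of_real (y \<bullet> s) in C2 0 t = C 0 t \<and> D2 0 t = D 0 t"
  shows "\<forall>j. \<forall>(x, y)\<in>\<Omega>. let t = of_real (y \<bullet> s) in C2 j t = C j t \<and> D2 j t = D j t"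
    and "\<forall>z\<in>\<Omega>. F2 z = F z"
proof -
  interpret w1: plane_wave s \<Omega> U C D F by fact
  interpret w2: plane_wave s \<Omega> U C2 D2 F2 by fact
  let ?b = "beta CARD('b)"
  have b0: "?b (Suc j) \<noteq> 0" for j
    using abs_real_beta_ge [of "Suc j" "CARD('b)"] by (auto simp: beta_eq_of_real)
  have "C2 j (of_real t) = C j (of_real t) \<and> D2 j (of_real t) = D j (of_real t)" if "t \<in> w1.phases" for j t
    using that
  proof (induction j arbitrary: t)
    case 0
    then show ?case using init by (auto simp: w1.phases_def Let_def)
  next
    case (Suc j)
    have "deriv (C2 j) (of_real t) = deriv (C j) (of_real t)"
      "deriv (D2 j) (of_real t) = deriv (D j) (of_real t)"
      by (rule deriv_eq_of_eq_on_reals [OF _ _ w1.U(1) w1.open_phases w1.phases_in_U _ Suc.prems];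
          use w1.CD w2.CD Suc.IH in auto)+
    moreover have "?b (Suc j) * C (Suc j) (of_real t) = (- 1) ^ j * deriv (D j) (of_real t)"
      "?b (Suc j) * D (Suc j) (of_real t) = - ((- 1) ^ j * deriv (C j) (of_real t))"
      using Suc.prems hyp(1) unfolding w1.hypermonogenic_iff_recurrence
      by (auto simp: w1.phases_def Let_def eq_neg_iff_add_eq_0)
    moreover have "?b (Suc j) * C2 (Suc j) (of_real t) = (- 1) ^ j * deriv (D2 j) (of_real t)"
      "?b (Suc j) * D2 (Suc j) (of_real t) = - ((- 1) ^ j * deriv (C2 j) (of_real t))"
      using Suc.prems hyp(2) unfolding w2.hypermonogenic_iff_recurrence
      by (auto simp: w1.phases_def Let_def eq_neg_iff_add_eq_0)
    ultimately show ?case using b0 [of j] by (metis mult_left_cancel)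
  qed
  then have eq: "C2 j (of_real (y \<bullet> s)) = C j (of_real (y \<bullet> s))"
    "D2 j (of_real (y \<bullet> s)) = D j (of_real (y \<bullet> s))" if "(x, y) \<in> \<Omega>" for j x y
    using w1.phases_I [OF that] by blast+
  then show "\<forall>j. \<forall>(x, y)\<in>\<Omega>. let t = of_real (y \<bullet> s) in C2 j t = C j t \<and> D2 j t = D j t"
    by (auto simp: Let_def)
  show "\<forall>z\<in>\<Omega>. F2 z = F z"
  proof clarify
    fix x y assume xy: "(x, y) \<in> \<Omega>"
    then have "w2.amp j (y \<bullet> s) = w1.amp j (y \<bullet> s)" for j
      by (simp add: w1.amp_def w2.amp_def eq)
    then show "F2 (x, y) = F (x, y)"
      using w1.F_sums [OF xy] w2.F_sums [OF xy] by (simp add: sums_iff)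
  qed
qed

theorem proposition5p5:
  fixes s :: "real ^ 'q::{finite,linorder}"
    and \<Omega> :: "((real ^ 'p::{finite,linorder}) \<times> (real ^ 'q::_)) set"
    and U :: "complex set"
    and C D :: "nat \<Rightarrow> complex \<Rightarrow> complex"
    and F :: "(real ^ 'p::_) \<times> (real ^ 'q::_) \<Rightarrow> ('p + 'q) clifford"
  assumes s: "s \<in> sphere 0 1"
    and \<Omega>: "open \<Omega>"
    and U: "open U" "\<And>x y. (x, y) \<in> \<Omega> \<Longrightarrow> of_real (y \<bullet> s) \<in> U"
    and CD: "\<And>j. C j holomorphic_on U" "\<And>j. D j holomorphic_on U"
    and F: "plane_wave_on \<Omega> s C D F"
  shows "(hypermonogenic_on \<Omega> F \<longleftrightarrow>
      (\<forall>j. \<forall>(x, y)\<in>\<Omega>. let t = of_real (y \<bullet> s) in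
        beta CARD('p) (j + 1) * C (j + 1) t - (-1) ^ j * deriv (D j) t = 0 \<and>
        beta CARD('p) (j + 1) * D (j + 1) t + (-1) ^ j * deriv (C j) t = 0))
    \<and> (hypermonogenic_on \<Omega> F \<longrightarrow>
      (\<forall>C2 D2 F2. (\<forall>j. C2 j holomorphic_on U \<and> D2 j holomorphic_on U) \<longrightarrow>
        plane_wave_on \<Omega> s C2 D2 F2 \<longrightarrow> hypermonogenic_on \<Omega> F2 \<longrightarrow>
        (\<forall>(x, y)\<in>\<Omega>. let t = of_real (y \<bullet> s) in C2 0 t = C 0 t \<and> D2 0 t = D 0 t) \<longrightarrow>
        (\<forall>j. \<forall>(x, y)\<in>\<Omega>. let t = of_real (y \<bullet> s) in C2 j t = C j t \<and> D2 j t = D j t) \<and>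
        (\<forall>z\<in>\<Omega>. F2 z = F z)))"
proof -
  have wave: "plane_wave s \<Omega> U C' D' F'"
    if "\<And>j. C' j holomorphic_on U" "\<And>j. D' j holomorphic_on U" "plane_wave_on \<Omega> s C' D' F'"
    for C' D' and F' :: "(real ^ 'p::_) \<times> (real ^ 'q::_) \<Rightarrow> ('p + 'q) clifford"
    using that s \<Omega> U by unfold_locales auto
  note w = wave [OF CD F]
  show ?thesis
    using plane_wave.hypermonogenic_iff_recurrence [OF w] plane_wave_determined [OF w wave]
    by blast
qed

end
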